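(* Let $(I,\mathcal{E},g)$ be a percolation Markov decision process (PMDP) on $\mathbb{Z}^d$, let $z\in\mathbb{Z}^d$ be an initial state, and let $v_\infty(z)$ be the limit value. Then there exists a 0-optimal strategy that attains the limit value, that is, there exists $\sigma\in\Sigma$ such that $$\gamma_n(z,\sigma)\to v_\infty(z)\quad\text{as } n\to\infty,\ \mathbb{P}\text{-a.s.}$$ In particular, the PMDP starting at $z$ has a uniform value, which, except for the trivial PMDP ($I=\{0\}$), is deterministic and independent of the initial state $z$.
   Context: A PMDP on $\mathbb{Z}^d$ is a tuple $(I,\mathcal{E},g)$ where $I\subset\mathbb{Z}^d$ is a non-empty finite set (the action set), $\mathcal{E}=(\Omega,\mathscr{F},\mathbb{P})$ is a probability space, and $g=\{\omega\mapsto g_\omega(z,i)\}_{(z,i)\in\mathbb{Z}^d\times I}$ is a collection of uniformly bounded, i.i.d. real-valued random variables on $\Omega$. Let $\mathcal{F}_{\mathrm{all}}=\sigma(\{\omega\mapsto g_\omega(z,i): z\in\mathbb{Z}^d,i\in I\})$. A strategy is a sequence $\sigma=(\sigma_m)_{m\ge1}$ of mappings $\sigma_m:\Omega\times\mathbb{Z}^d\to I$, each measurable with respect to $\mathcal{F}_{\mathrm{all}}\otimes\mathcal{P}(\mathbb{Z}^d)$; $\Sigma$ is the set of strategies. Given an initial state $z$ and $\omega$, $\sigma$ induces the play $z_1=z$, $i_m=\sigma_m(\omega,z)$, $z_{m+1}=z_m+i_m$ for $m\ge1$. The $n$-stage payoff is $\gamma_n^\omega(z,\sigma)=\frac1n\sum_{m=1}^n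 g_\omega(z_m,i_m)$ and the $n$-stage value is $v_n^\omega(z)=\max_{\sigma\in\Sigma}\gamma_n^\omega(z,\sigma)$; $\gamma_n(z,\sigma)$ and $v_n(z)$ denote the corresponding random variables. The limit value $v_\infty(z)$ is the $\mathbb{P}$-almost sure limit of $v_n(z)$ as $n\to\infty$ (it exists for every PMDP). The PMDP starting at $z$ has a uniform value if the limit value $v_\infty(z)$ exists and for every $\varepsilon>0$ there is $\sigma\in\Sigma$ such that, $\mathbb{P}$-almost surely, there exists $n_0\in\mathbb{N}$ with $\gamma_n(z,\sigma)\ge v_\infty(z)-\varepsilon$ for all $n\ge n_0$; in this case $v_\infty(z)$ is called the uniform value. *)

theory Defs
  imports "HOL-Probability.Probability"
begin

text \<open>The lattice \<open>\<int>\<^sup>d\<close> is the type \<^typ>\<open>int ^ 'd\<close> with \<open>d = CARD('d)\<close>. The random payoff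
  \<open>g\<^sub>\<omega>(z, i)\<close> is written \<open>g \<omega> z i\<close>; only its values for \<open>i \<in> I\<close> matter.\<close>

locale pmdp = prob_space M
  for M :: "'w measure"
  and I :: "(int ^ 'd) set"
  and g :: "'w \<Rightarrow> int ^ 'd \<Rightarrow> int ^ 'd \<Rightarrow> real" +
  assumes finite_actions: "finite I"
    and nonempty_actions: "I \<noteq> {}"
    and bounded_payoffs: "\<exists>C. \<forall>\<omega>\<in>space M. \<forall>z. \<forall>i\<in>I. \<bar>g \<omega> z i\<bar> \<le> C"
    and indep_payoffs: "indep_vars (\<lambda>_. borel) (\<lambda>(z, i) \<omega>. g \<omega> z i) (UNIV \<times> I)"
    and identically_distributed_payoffs:
      "\<And>z i z' i'. i \<in> I \<Longrightarrow> i' \<in> I \<Longrightarrow>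
         distr M borel (\<lambda>\<omega>. g \<omega> z i) = distr M borel (\<lambda>\<omega>. g \<omega> z' i')"
begin

definition F_all :: "'w measure" where
  "F_all = sigma (space M)
     {(\<lambda>\<omega>. g \<omega> z i) -` B \<inter> space M | z i B. i \<in> I \<and> B \<in> sets borel}"

text \<open>Stages are numbered from 1, so the value of a strategy at index 0 is irrelevant
  and left unconstrained.\<close>

definition strategies :: "(nat \<Rightarrow> 'w \<times> (int ^ 'd) \<Rightarrow> int ^ 'd) set" where
  "strategies = {\<sigma>. \<forall>m\<ge>1. \<sigma> m \<in> F_all \<Otimes>\<^sub>M count_space UNIV \<rightarrow>\<^sub>M count_space I}"

text \<open>The action at stage \<open>m\<close> is \<open>\<sigma> m (\<omega>, z)\<close> with \<open>z\<close> the \<^emph>\<open>initial\<close> state, not the current one.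
  The state at stage \<open>m \<ge> 1\<close> is \<open>play \<sigma> \<omega> z m\<close>; index 0 is a dummy.\<close>

fun play :: "(nat \<Rightarrow> 'w \<times> (int ^ 'd) \<Rightarrow> int ^ 'd) \<Rightarrow> 'w \<Rightarrow> int ^ 'd \<Rightarrow> nat \<Rightarrow> int ^ 'd" where
  "play \<sigma> \<omega> z 0 = z"
| "play \<sigma> \<omega> z (Suc 0) = z"
| "play \<sigma> \<omega> z (Suc (Suc m)) = play \<sigma> \<omega> z (Suc m) + \<sigma> (Suc m) (\<omega>, z)"

definition payoff ::
  "nat \<Rightarrow> int ^ 'd \<Rightarrow> (nat \<Rightarrow> 'w \<times> (int ^ 'd) \<Rightarrow> int ^ 'd) \<Rightarrow> 'w \<Rightarrow> real" where
  "payoff n z \<sigma> \<omega> = (1 / real n) * (\<Sum>m=1..n. g \<omega> (play \<sigma> \<omega> z m) (\<sigma> m (\<omega>, z)))"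

definition stage_value :: "nat \<Rightarrow> int ^ 'd \<Rightarrow> 'w \<Rightarrow> real" where
  "stage_value n z \<omega> = Max ((\<lambda>\<sigma>. payoff n z \<sigma> \<omega>) ` strategies)"

text \<open>Meaningful only where the sequence of \<open>n\<close>-stage values converges; almost sure
  convergence is part of \<open>has_uniform_value\<close>.\<close>

definition limit_value :: "int ^ 'd \<Rightarrow> 'w \<Rightarrow> real" where
  "limit_value z \<omega> = lim (\<lambda>n. stage_value n z \<omega>)"

definition has_uniform_value :: "int ^ 'd \<Rightarrow> bool" where
  "has_uniform_value z \<longleftrightarrow>
     (AE \<omega> in M. convergent (\<lambda>n. stage_value n z \<omega>)) \<and>
     (\<forall>\<epsilon>>0. \<exists>\<sigma>\<in>strategies. AE \<omega> in M.
        \<exists>n0. \<forall>n\<ge>n0. payoff n z \<sigma> \<omega> \<ge> limit_value z \<omega> - \<epsilon>)"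

text \<open>The set whose \<^const>\<open>Max\<close> defines \<open>stage_value\<close> is finite and non-empty,
  so the maximum is attained.\<close>

lemma play_cong:
  assumes "\<And>k. 1 \<le> k \<Longrightarrow> k < m \<Longrightarrow> \<sigma> k (\<omega>, z) = \<tau> k (\<omega>, z)"
  shows "play \<sigma> \<omega> z m = play \<tau> \<omega> z m"
  using assms by (induction \<sigma> \<omega> z m rule: play.induct) auto

lemma strategies_nonempty: "strategies \<noteq> {}"
proof -
  obtain i where "i \<in> I" using nonempty_actions by blast
  then have "(\<lambda>_ _. i) \<in> strategies" by (auto simp: strategies_def)
  then show ?thesis by blast
qed

lemma finite_payoffs:
  assumes "\<omega> \<in> space M"
  shows "finite ((\<lambda>\<sigma>. payoff n z \<sigma> \<omega>) ` strategies)"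
proof -
  let ?r = "\<lambda>\<sigma>. restrict (\<lambda>m. \<sigma> m (\<omega>, z)) {1..n}"
  let ?p = "\<lambda>a. payoff n z (\<lambda>m _. a m) \<omega>"
  have act: "\<sigma> m (\<omega>, z) \<in> I" if "\<sigma> \<in> strategies" "1 \<le> m" for \<sigma> m
    using that assms measurable_space[of "\<sigma> m" "F_all \<Otimes>\<^sub>M count_space UNIV" "count_space I" "(\<omega>, z)"]
    by (auto simp: strategies_def space_pair_measure F_all_def space_measure_of_conv)
  have "payoff n z \<sigma> \<omega> = ?p (?r \<sigma>)" for \<sigma>
    unfolding payoff_def
    by (intro arg_cong2[where f = "(*)"] refl sum.cong arg_cong2[where f = "g \<omega>"] play_cong) auto
  then have "(\<lambda>\<sigma>. payoff n z \<sigma> \<omega>) ` strategies \<subseteq> ?p ` ({1..n} \<rightarrow>\<^sub>E I)"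
    using act by (fastforce simp: image_iff)
  moreover have "finite ({1..n} \<rightarrow>\<^sub>E I)"
    by (intro finite_PiE) (auto simp: finite_actions)
  ultimately show ?thesis by (rule finite_subset[OF _ finite_imageI])
qed

lemma stage_value_attained:
  assumes "\<omega> \<in> space M"
  shows "\<exists>\<sigma>\<in>strategies. stage_value n z \<omega> = payoff n z \<sigma> \<omega>"
    and "\<sigma> \<in> strategies \<Longrightarrow> payoff n z \<sigma> \<omega> \<le> stage_value n z \<omega>"
proof -
  have "stage_value n z \<omega> \<in> (\<lambda>\<sigma>. payoff n z \<sigma> \<omega>) ` strategies"
    unfolding stage_value_def
    by (rule Max_in) (use finite_payoffs[OF assms] strategies_nonempty in auto)
  then show "\<exists>\<sigma>\<in>strategies. stage_value n z \<omega> = payoff n z \<sigma> \<omega>" by blast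
qed (auto simp: stage_value_def intro!: Max_ge finite_payoffs assms)

end

end

theory Submission
  imports Defs "HOL-Real_Asymp.Real_Asymp" "HOL-Library.Discrete_Functions"
begin

text \<open>The \<open>n\<close>-stage value times \<open>n\<close> is the optimal total \<open>V n x\<close> of a path of length \<open>n\<close>. Suppose
  that \<open>V n x\<close> deviates from \<open>c n\<close> by \<open>\<epsilon> n\<close> with probability at most \<open>K exp (- \<kappa> \<surd>n)\<close>. A path of length
  \<open>n\<^sup>2\<close> reaches only polynomially many states, so by Borel--Cantelli almost surely, for all large \<open>n\<close>,
  all of them satisfy \<open>V n x \<approx> c n\<close>; playing optimally in consecutive blocks of lengths 1, 2, 3, \<dots>
  then has average payoff \<open>c\<close>.

  If 0 lies in the convex hull of \<open>I \<noteq> {0}\<close>, simultaneous Diophantine approximation gives a closed loop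
  of actions, \<open>c\<close> is the essential supremum of the payoffs, and the deviation bound comes from
  independent trials to find a good loop. Otherwise a linear functional is at least 1 on \<open>I\<close>, so a path
  visits each of its level slabs at most once and McDiarmid's inequality gives concentration of
  \<open>V n x\<close> around its mean; comparing scales \<open>n\<close> and \<open>N \<in> [n\<^sup>2, n\<^sup>4]\<close> shows that the means
  divided by \<open>n\<close> converge.\<close>

section \<open>Bounded differences\<close>

text \<open>Strategies may look at the whole random field, so playing optimally for a fixed horizon
  is admissible; the obstacle is that one strategy must serve all horizons. The state in which a
  block ends depends on the field, so the optimum from there is not independent of the past. Uniform
  control over all reachable states replaces independence, and it needs a rate that beats their
  polynomial number.

  The case split is about reuse of payoffs. If paths can loop, changing one payoff may change
  \<open>V n x\<close> by order \<open>n\<close>, so bounded differences are useless; but the same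
  reuse lets a path collect the best payoffs forever. If they cannot, a whole slab, however many
  payoffs it holds, influences \<open>V n x\<close> by a bounded amount.

  The window for \<open>N\<close> has two ends for two reasons: union bounds over the states need
  \<open>N\<close> polynomial in \<open>n\<close>, while \<open>N \<ge> n\<^sup>2\<close> makes a
  leftover shorter than \<open>n\<close> negligible. Iterating the window covers all large
  \<open>N\<close>.\<close>

lemma (in prob_space) bounded_exp_moment:
  fixes f :: "'a \<Rightarrow> real"
  assumes [measurable]: "f \<in> borel_measurable M"
    and mean: "AE x in M. \<bar>f x - expectation f\<bar> \<le> c" and "0 < t"
  shows "expectation (\<lambda>x. exp (t * (f x - expectation f))) \<le> exp (t\<^sup>2 * c\<^sup>2 / 2)"
proof -
  interpret interval_bounded_random_variable M f "expectation f - c" "expectation f + c"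
    by unfold_locales (use mean in \<open>auto elim!: eventually_mono\<close>)
  have "integrable M (\<lambda>x. exp (t * (f x - expectation f)))"
    by (rule integrable_const_bound[where B = "exp (t * c)"])
       (use mean \<open>0 < t\<close> in \<open>auto elim!: eventually_mono\<close>)
  then have "ennreal (expectation (\<lambda>x. exp (t * (f x - expectation f)))) =
      (\<integral>\<^sup>+x. ennreal (exp (t * (f x - expectation f))) \<partial>M)"
    by (subst nn_integral_eq_integral) auto
  also have "\<dots> \<le> ennreal (exp (t\<^sup>2 * ((expectation f + c) - (expectation f - c))\<^sup>2 / 8))"
    by (rule Hoeffdings_lemma_nn_integral[OF \<open>0 < t\<close>])
  also have "t\<^sup>2 * ((expectation f + c) - (expectation f - c))\<^sup>2 / 8 = t\<^sup>2 * c\<^sup>2 / 2"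
    by (simp add: power2_eq_square algebra_simps)
  finally show ?thesis by simp
qed

text \<open>Conditioning on all other blocks confines the function to an interval of half-width \<open>c\<close> around its
  conditional mean, rather than the optimal width \<open>c\<close>; this costs a factor 4 in the exponent.\<close>

lemma PiM_bounded_differences_exp:
  fixes N :: "'i \<Rightarrow> 'a measure" and s :: "'i \<Rightarrow> 'l" and f :: "('i \<Rightarrow> 'a) \<Rightarrow> real"
  assumes N: "\<And>i. prob_space (N i)"
    and "finite L" "finite J" "s ` J \<subseteq> L"
    and "f \<in> borel_measurable (PiM J N)"
    and "\<And>x. x \<in> space (PiM J N) \<Longrightarrow> \<bar>f x\<bar> \<le> B"
    and "\<And>l x y. l \<in> L \<Longrightarrow> x \<in> space (PiM J N) \<Longrightarrow> y \<in> space (PiM J N) \<Longrightarrow>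
           (\<And>i. i \<in> J \<Longrightarrow> s i \<noteq> l \<Longrightarrow> x i = y i) \<Longrightarrow> \<bar>f x - f y\<bar> \<le> c"
    and "0 < t"
  shows "(\<integral>x. exp (t * (f x - (\<integral>y. f y \<partial>PiM J N))) \<partial>PiM J N) \<le> exp (t\<^sup>2 * c\<^sup>2 / 2 * card L)"
  using assms(2-7)
proof (induction L arbitrary: J f)
  case empty
  interpret P: prob_space "PiM J N" by (intro prob_space_PiM N)
  \<comment> \<open>No labels forces \<open>J = {}\<close>, and the empty product has a single
    point.\<close>
  have f: "f x = f (\<lambda>_. undefined)" if "x \<in> space (PiM J N)" for x
    using empty that by (auto simp: space_PiM)
  have "(\<integral>y. f y \<partial>PiM J N) = (\<integral>y. f (\<lambda>_. undefined) \<partial>PiM J N)"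
    by (intro Bochner_Integration.integral_cong refl f)
  also have "\<dots> = f (\<lambda>_. undefined)" by (simp add: P.prob_space)
  finally have "(\<integral>x. exp (t * (f x - (\<integral>y. f y \<partial>PiM J N))) \<partial>PiM J N) = (\<integral>x. 1 \<partial>PiM J N)"
    by (intro Bochner_Integration.integral_cong) (auto simp: f)
  then show ?case by (simp add: P.prob_space)
next
  case (insert l L)
  define J1 where "J1 = {i \<in> J. s i \<noteq> l}"
  define J2 where "J2 = {i \<in> J. s i = l}"
  have J: "J = J1 \<union> J2" "J1 \<inter> J2 = {}" "finite J1" "finite J2"
    using insert by (auto simp: J1_def J2_def)
  interpret N: product_prob_space N by (simp add: product_prob_space_def product_prob_space_axioms_def
      product_sigma_finite_def N prob_space_imp_sigma_finite)
  interpret P: prob_space "PiM J N" by (intro prob_space_PiM N)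
  interpret P1: prob_space "PiM J1 N" by (intro prob_space_PiM N)
  interpret P2: prob_space "PiM J2 N" by (intro prob_space_PiM N)
  note [measurable] = insert.prems(3)
  \<comment> \<open>\<open>F\<close> is the conditional mean given the coordinates outside block
    \<open>l\<close>. It inherits the bound \<open>B\<close> and the oscillation bound
    \<open>c\<close> for every remaining label, so the induction hypothesis applies to it on
    \<open>J1\<close>.\<close>
  define F where "F x = (\<integral>y. f (merge J1 J2 (x, y)) \<partial>PiM J2 N)" for x
  have [measurable]: "(\<lambda>(x, y). f (merge J1 J2 (x, y))) \<in> borel_measurable (PiM J1 N \<Otimes>\<^sub>M PiM J2 N)"
    using measurable_comp[OF measurable_merge insert.prems(3)[unfolded J(1)]]
    by (simp add: comp_def case_prod_beta)
  have [measurable]: "F \<in> borel_measurable (PiM J1 N)"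
    unfolding F_def by measurable
  have mem: "merge J1 J2 (x, y) \<in> space (PiM J N)"
    if "x \<in> space (PiM J1 N)" "y \<in> space (PiM J2 N)" for x y
    using that J by (auto simp: space_PiM PiE_iff extensional_def merge_def)
  have fm: "(\<lambda>y. f (merge J1 J2 (x, y))) \<in> borel_measurable (PiM J2 N)"
    if "x \<in> space (PiM J1 N)" for x
    using that by measurable
  have fi: "integrable (PiM J2 N) (\<lambda>y. f (merge J1 J2 (x, y)))"
    if "x \<in> space (PiM J1 N)" for x
    by (rule P2.integrable_const_bound[where B = B]) (use that fm insert.prems(4) mem in auto)
  have FB: "\<bar>F x\<bar> \<le> B" if x: "x \<in> space (PiM J1 N)" for x
  proof -
    have "\<bar>F x\<bar> \<le> (\<integral>y. \<bar>f (merge J1 J2 (x, y))\<bar> \<partial>PiM J2 N)"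
      unfolding F_def by (rule integral_abs_bound)
    also have "\<dots> \<le> (\<integral>y. B \<partial>PiM J2 N)"
      by (rule integral_mono) (use fi[OF x] insert.prems(4) mem[OF x] in auto)
    finally show ?thesis by (simp add: P2.prob_space)
  qed
  have near: "\<bar>f (merge J1 J2 (x, y)) - F x\<bar> \<le> c"
    if x: "x \<in> space (PiM J1 N)" and y: "y \<in> space (PiM J2 N)" for x y
  proof -
    have "f (merge J1 J2 (x, y)) - F x = (\<integral>y'. f (merge J1 J2 (x, y)) - f (merge J1 J2 (x, y')) \<partial>PiM J2 N)"
      unfolding F_def using fi[OF x] by (simp add: P2.prob_space)
    also have "\<bar>\<dots>\<bar> \<le> (\<integral>y'. \<bar>f (merge J1 J2 (x, y)) - f (merge J1 J2 (x, y'))\<bar> \<partial>PiM J2 N)"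
      by (rule integral_abs_bound)
    also have "\<dots> \<le> (\<integral>y'. c \<partial>PiM J2 N)"
    proof (rule integral_mono)
      show "\<bar>f (merge J1 J2 (x, y)) - f (merge J1 J2 (x, y'))\<bar> \<le> c" if y': "y' \<in> space (PiM J2 N)" for y'
        by (rule insert.prems(5)[OF _ mem[OF x y] mem[OF x y'], of l]) (auto simp: merge_def J1_def J2_def)
    qed (use fi[OF x] in auto)
    finally show ?thesis by (simp add: P2.prob_space)
  qed
  have E: "(\<integral>x. h x \<partial>PiM J N) = (\<integral>x. (\<integral>y. h (merge J1 J2 (x, y)) \<partial>PiM J2 N) \<partial>PiM J1 N)"
    if "integrable (PiM J N) h" for h :: "_ \<Rightarrow> real"
    using N.product_integral_fold[OF J(2-4), of h] that J(1) by simp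
  define m where "m = (\<integral>y. f y \<partial>PiM J N)"
  have m: "m = (\<integral>x. F x \<partial>PiM J1 N)"
    unfolding m_def F_def
    by (rule E) (auto intro!: P.integrable_const_bound[where B = B] insert.prems)
  have "(\<integral>x. exp (t * (f x - m)) \<partial>PiM J N) =
      (\<integral>x. (\<integral>y. exp (t * (f (merge J1 J2 (x, y)) - m)) \<partial>PiM J2 N) \<partial>PiM J1 N)"
  proof (rule E, rule P.integrable_const_bound[where B = "exp (t * (B - m))"])
    show "AE x in PiM J N. norm (exp (t * (f x - m))) \<le> exp (t * (B - m))"
      using insert.prems(4) \<open>0 < t\<close> by (intro AE_I2) (fastforce simp: abs_le_iff)
  qed auto
  also have "\<dots> \<le> (\<integral>x. exp (t * (F x - m)) * exp (t\<^sup>2 * c\<^sup>2 / 2) \<partial>PiM J1 N)"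
  proof (rule integral_mono_AE')
    show "integrable (PiM J1 N) (\<lambda>x. exp (t * (F x - m)) * exp (t\<^sup>2 * c\<^sup>2 / 2))"
    proof (intro integrable_mult_left P1.integrable_const_bound[where B = "exp (t * (B - m))"])
      show "AE x in PiM J1 N. norm (exp (t * (F x - m))) \<le> exp (t * (B - m))"
        using FB \<open>0 < t\<close> by (intro AE_I2) (fastforce simp: abs_le_iff)
    qed auto
    show "AE x in PiM J1 N. (\<integral>y. exp (t * (f (merge J1 J2 (x, y)) - m)) \<partial>PiM J2 N) \<le>
        exp (t * (F x - m)) * exp (t\<^sup>2 * c\<^sup>2 / 2)"
    proof (rule AE_I2)
      fix x assume x: "x \<in> space (PiM J1 N)"
      \<comment> \<open>Relative to the conditional mean the exponential factorises; what stays
        inside is the moment of a centred variable bounded by \<open>c\<close>.\<close>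
      have "(\<integral>y. exp (t * (f (merge J1 J2 (x, y)) - m)) \<partial>PiM J2 N) =
          exp (t * (F x - m)) * (\<integral>y. exp (t * (f (merge J1 J2 (x, y)) - F x)) \<partial>PiM J2 N)"
        by (subst integral_mult_right_zero[symmetric], rule Bochner_Integration.integral_cong)
          (simp_all add: algebra_simps flip: exp_add)
      also have "\<dots> \<le> exp (t * (F x - m)) * exp (t\<^sup>2 * c\<^sup>2 / 2)"
        using P2.bounded_exp_moment[OF fm[OF x] _ \<open>0 < t\<close>, of c] near[OF x]
        by (intro mult_left_mono) (auto simp: F_def)
      finally show "(\<integral>y. exp (t * (f (merge J1 J2 (x, y)) - m)) \<partial>PiM J2 N) \<le>
        exp (t * (F x - m)) * exp (t\<^sup>2 * c\<^sup>2 / 2)" .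
    qed
  qed auto
  also have "\<dots> = (\<integral>x. exp (t * (F x - m)) \<partial>PiM J1 N) * exp (t\<^sup>2 * c\<^sup>2 / 2)" by simp
  also have "\<dots> \<le> exp (t\<^sup>2 * c\<^sup>2 / 2 * card L) * exp (t\<^sup>2 * c\<^sup>2 / 2)"
    unfolding m
  proof (intro mult_right_mono insert.IH)
    fix k x y assume k: "k \<in> L" and x: "x \<in> space (PiM J1 N)" and y: "y \<in> space (PiM J1 N)"
      and xy: "\<And>i. i \<in> J1 \<Longrightarrow> s i \<noteq> k \<Longrightarrow> x i = y i"
    have "F x - F y = (\<integral>u. f (merge J1 J2 (x, u)) - f (merge J1 J2 (y, u)) \<partial>PiM J2 N)"
      unfolding F_def using fi[OF x] fi[OF y] by simp
    also have "\<bar>\<dots>\<bar> \<le> (\<integral>u. \<bar>f (merge J1 J2 (x, u)) - f (merge J1 J2 (y, u))\<bar> \<partial>PiM J2 N)"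
      by (rule integral_abs_bound)
    also have "\<dots> \<le> (\<integral>u. c \<partial>PiM J2 N)"
    proof (rule integral_mono)
      show "\<bar>f (merge J1 J2 (x, u)) - f (merge J1 J2 (y, u))\<bar> \<le> c" if u: "u \<in> space (PiM J2 N)" for u
        by (rule insert.prems(5)[OF _ mem[OF x u] mem[OF y u], of k]) (use k xy in \<open>auto simp: merge_def\<close>)
    qed (use fi[OF x] fi[OF y] in auto)
    finally show "\<bar>F x - F y\<bar> \<le> c" by (simp add: P2.prob_space)
  qed (use insert.prems(2) FB J(3) \<open>F \<in> _\<close> in \<open>auto simp: J1_def\<close>)
  also have "\<dots> = exp (t\<^sup>2 * c\<^sup>2 / 2 * card (insert l L))"
    using insert.hyps by (simp add: algebra_simps flip: exp_add)
  finally show ?case unfolding m_def .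
qed

text \<open>Chernoff's bound applied to the moment estimate above. The labels \<open>s\<close> group
  the coordinates, and only the number of groups enters: later, polynomially many payoffs fall into
  \<open>O(n)\<close> levels.\<close>

lemma mcdiarmid_ge:
  fixes N :: "'i \<Rightarrow> 'a measure" and s :: "'i \<Rightarrow> 'l" and f :: "('i \<Rightarrow> 'a) \<Rightarrow> real"
  assumes N: "\<And>i. prob_space (N i)"
    and L: "finite L" "L \<noteq> {}" and J: "finite J" "s ` J \<subseteq> L"
    and [measurable]: "f \<in> borel_measurable (PiM J N)"
    and B: "\<And>x. x \<in> space (PiM J N) \<Longrightarrow> \<bar>f x\<bar> \<le> B"
    and bd: "\<And>l x y. l \<in> L \<Longrightarrow> x \<in> space (PiM J N) \<Longrightarrow> y \<in> space (PiM J N) \<Longrightarrow>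
           (\<And>i. i \<in> J \<Longrightarrow> s i \<noteq> l \<Longrightarrow> x i = y i) \<Longrightarrow> \<bar>f x - f y\<bar> \<le> c"
    and "0 < c" "0 < a"
  shows "measure (PiM J N) {x \<in> space (PiM J N). a \<le> f x - (\<integral>y. f y \<partial>PiM J N)}
    \<le> exp (- (a\<^sup>2 / (2 * c\<^sup>2 * card L)))"
proof -
  interpret P: prob_space "PiM J N" by (intro prob_space_PiM N)
  define m where "m = (\<integral>y. f y \<partial>PiM J N)"
  \<comment> \<open>The minimiser of
    \<open>t\<^sup>2 * c\<^sup>2 / 2 * card L - t * a\<close>.\<close>
  define t where "t = a / (c\<^sup>2 * card L)"
  have k: "0 < card L" using L by (simp add: card_gt_0_iff)
  then have t: "0 < t" using \<open>0 < c\<close> \<open>0 < a\<close> by (simp add: t_def)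
  have "measure (PiM J N) {x \<in> space (PiM J N). a \<le> f x - m}
      \<le> exp (- t * a) * (\<integral>x\<in>space (PiM J N). exp (t * (f x - m)) \<partial>PiM J N)"
  proof (rule P.Chernoff_ineq_ge[OF t])
    have "integrable (PiM J N) (\<lambda>x. exp (t * (f x - m)))"
    proof (rule P.integrable_const_bound[where B = "exp (t * (B - m))"])
      show "AE x in PiM J N. norm (exp (t * (f x - m))) \<le> exp (t * (B - m))"
        using B t by (intro AE_I2) (fastforce simp: abs_le_iff)
    qed auto
    then show "set_integrable (PiM J N) (space (PiM J N)) (\<lambda>x. exp (t * (f x - m)))"
      by (simp add: set_integrable_def cong: Bochner_Integration.integrable_cong)
  qed auto
  also have "\<dots> = exp (- t * a) * (\<integral>x. exp (t * (f x - m)) \<partial>PiM J N)"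
    by (simp add: set_lebesgue_integral_def cong: Bochner_Integration.integral_cong)
  also have "\<dots> \<le> exp (- t * a) * exp (t\<^sup>2 * c\<^sup>2 / 2 * card L)"
    unfolding m_def
    by (intro mult_left_mono PiM_bounded_differences_exp[OF N, where s = s and B = B])
      (use assms t in auto)
  also have "\<dots> = exp (- (a\<^sup>2 / (2 * c\<^sup>2 * card L)))"
    using k \<open>0 < c\<close> by (simp add: t_def field_simps power2_eq_square flip: exp_add)
  finally show ?thesis unfolding m_def .
qed

section \<open>Optimal totals and reachable states\<close>

text \<open>Bellman's recursion, stated for a fixed payoff field \<open>\<eta>\<close> so that it
  applies equally to \<open>g \<omega>\<close>, to its translates and to points of a product
  space.\<close>

fun best_total :: "(int ^ 'd) set \<Rightarrow> nat \<Rightarrow> int ^ 'd \<Rightarrow> (int ^ 'd \<Rightarrow> int ^ 'd \<Rightarrow> real) \<Rightarrow> real" where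
  "best_total I 0 x \<eta> = 0"
| "best_total I (Suc n) x \<eta> = Max ((\<lambda>i. \<eta> x i + best_total I n (x + i) \<eta>) ` I)"

text \<open>The action is a function of the set of maximisers. That set is a measurable random
  subset of a finite set, so the action is measurable whichever maximiser \<open>SOME\<close> picks.
  The number \<open>n\<close> of steps still to be made includes the current one.\<close>

definition greedy :: "(int ^ 'd) set \<Rightarrow> nat \<Rightarrow> int ^ 'd \<Rightarrow> (int ^ 'd \<Rightarrow> int ^ 'd \<Rightarrow> real) \<Rightarrow> int ^ 'd" where
  "greedy I n x \<eta> = (SOME i. i \<in> {i \<in> I. \<forall>j\<in>I.
     \<eta> x j + best_total I (n - 1) (x + j) \<eta> \<le> \<eta> x i + best_total I (n - 1) (x + i) \<eta>})"

text \<open>A superset of the states reachable within \<open>T\<close> steps: each action may be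
  used up to \<open>T\<close> times, independently of the others. Unlike the set of states reached
  at time \<open>T\<close>, it is monotone in \<open>T\<close>, and its size is visibly
  polynomial.\<close>

definition reach_box :: "(int ^ 'd) set \<Rightarrow> int ^ 'd \<Rightarrow> nat \<Rightarrow> (int ^ 'd) set" where
  "reach_box I x T = (\<lambda>k. x + (\<Sum>i\<in>I. int (k i) *s i)) ` (I \<rightarrow>\<^sub>E {..T})"

fun walk :: "int ^ 'd \<Rightarrow> (nat \<Rightarrow> int ^ 'd) \<Rightarrow> nat \<Rightarrow> int ^ 'd" where
  "walk x a 0 = x"
| "walk x a (Suc t) = walk x a t + a t"

lemma reach_box_self: "x \<in> reach_box I x T"
  unfolding reach_box_def by (rule image_eqI[where x = "\<lambda>i\<in>I. 0"]) auto

lemma reach_box_mono: "T \<le> T' \<Longrightarrow> reach_box I x T \<subseteq> reach_box I x T'"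
  unfolding reach_box_def by (intro image_mono PiE_mono) auto

lemma finite_reach_box: "finite I \<Longrightarrow> finite (reach_box I x T)"
  unfolding reach_box_def by (intro finite_imageI finite_PiE) auto

lemma card_reach_box_le:
  assumes "finite I" shows "card (reach_box I x T) \<le> (T + 1) ^ card I"
proof -
  have "card (reach_box I x T) \<le> card (I \<rightarrow>\<^sub>E {..T})"
    unfolding reach_box_def using assms by (intro card_image_le finite_PiE) auto
  then show ?thesis using assms by (simp add: card_PiE)
qed

lemma reach_box_step:
  assumes "finite I" "y \<in> reach_box I x T" "i \<in> I"
  shows "y + i \<in> reach_box I x (Suc T)"
proof -
  obtain k where k: "k \<in> I \<rightarrow>\<^sub>E {..T}" "y = x + (\<Sum>j\<in>I. int (k j) *s j)"
    using assms by (auto simp: reach_box_def)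
  have suc: "int (Suc m) *s j = int m *s j + j" for m and j :: "int ^ 'd"
    by (simp add: vec_eq_iff algebra_simps)
  have "(\<Sum>j\<in>I. int ((k(i := Suc (k i))) j) *s j) = (\<Sum>j\<in>I. int (k j) *s j + (if j = i then i else 0))"
    by (intro sum.cong refl) (auto simp: suc simp del: of_nat_Suc)
  also have "\<dots> = (\<Sum>j\<in>I. int (k j) *s j) + i"
    using assms by (simp add: sum.distrib)
  finally have "y + i = x + (\<Sum>j\<in>I. int ((k(i := Suc (k i))) j) *s j)"
    using k by simp
  moreover have "k(i := Suc (k i)) \<in> I \<rightarrow>\<^sub>E {..Suc T}"
    using k \<open>i \<in> I\<close> by (force simp: PiE_iff extensional_def)
  ultimately show ?thesis unfolding reach_box_def by blast
qed

lemma reach_box_translate: "y \<in> reach_box I x T \<longleftrightarrow> y - x \<in> reach_box I 0 T"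
  by (force simp: reach_box_def image_iff algebra_simps)

lemma reach_box_shift:
  assumes "finite I" "i \<in> I" shows "reach_box I (x + i) T \<subseteq> reach_box I x (Suc T)"
proof
  fix y assume "y \<in> reach_box I (x + i) T"
  then have "(y - i) \<in> reach_box I x T" 

    unfolding reach_box_translate[of y I "x + i"] reach_box_translate[of "y - i" I x]
    by (metis add.commute diff_diff_eq)
  from reach_box_step[OF assms(1) this assms(2)] show "y \<in> reach_box I x (Suc T)" by simp
qed

context
  fixes I :: "(int ^ 'd) set"
  assumes I: "finite I" "I \<noteq> {}"
begin

lemma best_total_ge: "i \<in> I \<Longrightarrow> \<eta> x i + best_total I n (x + i) \<eta> \<le> best_total I (Suc n) x \<eta>"
  using I by (auto intro!: Max_ge)

lemma best_total_attained: "\<exists>i\<in>I. best_total I (Suc n) x \<eta> = \<eta> x i + best_total I n (x + i) \<eta>"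
proof -
  have "best_total I (Suc n) x \<eta> \<in> (\<lambda>i. \<eta> x i + best_total I n (x + i) \<eta>) ` I"
    unfolding best_total.simps by (rule Max_in) (use I in auto)
  then show ?thesis by auto
qed

lemma best_total_leI:
  "(\<And>i. i \<in> I \<Longrightarrow> \<eta> x i + best_total I n (x + i) \<eta> \<le> u) \<Longrightarrow> best_total I (Suc n) x \<eta> \<le> u"
  using best_total_attained[of n x \<eta>] by auto

lemma
  shows greedy_in: "greedy I n x \<eta> \<in> I"
    and greedy_opt: "0 < n \<Longrightarrow> \<eta> x (greedy I n x \<eta>) + best_total I (n - 1) (x + greedy I n x \<eta>) \<eta> = best_total I n x \<eta>"
proof -
  let ?A = "{i \<in> I. \<forall>j\<in>I. \<eta> x j + best_total I (n - 1) (x + j) \<eta> \<le> \<eta> x i + best_total I (n - 1) (x + i) \<eta>}"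
  obtain i where "i \<in> I" "best_total I (Suc (n - 1)) x \<eta> = \<eta> x i + best_total I (n - 1) (x + i) \<eta>"
    using best_total_attained by blast
  then have "i \<in> ?A" using best_total_ge[of _ \<eta> x "n - 1"] by auto
  then have *: "greedy I n x \<eta> \<in> ?A"
    unfolding greedy_def by (rule someI)
  then show "greedy I n x \<eta> \<in> I" by simp
  show "\<eta> x (greedy I n x \<eta>) + best_total I (n - 1) (x + greedy I n x \<eta>) \<eta> = best_total I n x \<eta>" if "0 < n"
  proof -
    have "best_total I (Suc (n - 1)) x \<eta> \<le> \<eta> x (greedy I n x \<eta>) + best_total I (n - 1) (x + greedy I n x \<eta>) \<eta>"
      using * by (intro best_total_leI) auto
    then show ?thesis
      using best_total_ge[OF \<open>greedy I n x \<eta> \<in> I\<close>, of \<eta> x "n - 1"] that by (simp del: best_total.simps)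
  qed
qed

lemma best_total_ge_walk:
  assumes "\<And>t. t < n \<Longrightarrow> a t \<in> I"
  shows "(\<Sum>t<n. \<eta> (walk x a t) (a t)) \<le> best_total I n x \<eta>"
proof -
  have "(\<Sum>t<k. \<eta> (walk x a t) (a t)) + best_total I (n - k) (walk x a k) \<eta> \<le> best_total I n x \<eta>" if "k \<le> n" for k
    using that
  proof (induction k)
    case (Suc k)
    have "\<eta> (walk x a k) (a k) + best_total I (n - Suc k) (walk x a (Suc k)) \<eta> \<le> best_total I (Suc (n - Suc k)) (walk x a k) \<eta>"
      using best_total_ge assms Suc.prems by (simp del: best_total.simps)
    also have "Suc (n - Suc k) = n - k" using Suc.prems by simp
    finally show ?case using Suc by simp
  qed simp
  from this[of n] show ?thesis by simp
qed

lemma best_total_bounded: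
  assumes "\<And>y i. i \<in> I \<Longrightarrow> \<bar>\<eta> y i\<bar> \<le> C"
  shows "\<bar>best_total I n x \<eta>\<bar> \<le> n * C"
proof (induction n arbitrary: x)
  case (Suc n)
  obtain i where i: "i \<in> I" "best_total I (Suc n) x \<eta> = \<eta> x i + best_total I n (x + i) \<eta>"
    using best_total_attained by blast
  then show ?case using Suc[of "x + i"] assms[of i x] by (simp add: algebra_simps)
qed simp

lemma best_total_le:
  assumes "\<And>y i. i \<in> I \<Longrightarrow> \<eta> y i \<le> C"
  shows "best_total I n x \<eta> \<le> n * C"
proof (induction n arbitrary: x)
  case (Suc n)
  obtain i where i: "i \<in> I" "best_total I (Suc n) x \<eta> = \<eta> x i + best_total I n (x + i) \<eta>"
    using best_total_attained by blast
  then show ?case using Suc[of "x + i"] assms[of i x] by (simp add: algebra_simps)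
qed simp

lemma best_total_cong:
  assumes "\<And>y i. y \<in> reach_box I x n \<Longrightarrow> i \<in> I \<Longrightarrow> \<eta> y i = \<eta>' y i"
  shows "best_total I n x \<eta> = best_total I n x \<eta>'"
  using assms
proof (induction n arbitrary: x)
  case (Suc n)
  have "best_total I n (x + i) \<eta> = best_total I n (x + i) \<eta>'" if "i \<in> I" for i
    using reach_box_shift[OF I(1) that] that Suc.prems by (intro Suc.IH) blast+
  moreover have "\<eta> x i = \<eta>' x i" if "i \<in> I" for i
    using Suc.prems reach_box_self that by blast
  ultimately show ?case by (simp cong: image_cong_simp)
qed simp

lemma best_total_translate:
  "best_total I n (v + x) \<eta> = best_total I n x (\<lambda>y. \<eta> (v + y))"
  by (induction n arbitrary: x) (simp_all add: add.assoc)

text \<open>Follow an optimal path for \<open>m\<close> steps and continue optimally. Its endpoint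
  depends on \<open>\<eta>\<close>, so the continuation must be good from every state of the
  box.\<close>

lemma best_total_add_ge:
  assumes "\<And>y. y \<in> reach_box I x m \<Longrightarrow> \<alpha> \<le> best_total I n y \<eta>"
  shows "best_total I m x \<eta> + \<alpha> \<le> best_total I (m + n) x \<eta>"
  using assms
proof (induction m arbitrary: x)
  case 0
  then show ?case using reach_box_self[of x I 0] by simp
next
  case (Suc m)
  obtain i where i: "i \<in> I" "best_total I (Suc m) x \<eta> = \<eta> x i + best_total I m (x + i) \<eta>"
    using best_total_attained by blast
  have "best_total I m (x + i) \<eta> + \<alpha> \<le> best_total I (m + n) (x + i) \<eta>"
    using reach_box_shift[OF I(1) i(1)] Suc.prems by (intro Suc.IH) blast
  with best_total_ge[OF i(1), of \<eta> x "m + n"] i(2) show ?case by (simp del: best_total.simps)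
qed

text \<open>The \<open>r\<close> leftover steps come first and lose at most \<open>C\<close> each;
  \<open>q\<close> blocks of length \<open>n\<close> follow, all starting inside the box.\<close>

lemma best_total_chain_ge:
  assumes C: "\<And>y i. i \<in> I \<Longrightarrow> \<bar>\<eta> y i\<bar> \<le> C"
    and "\<And>y. y \<in> reach_box I x (q * n + r) \<Longrightarrow> \<alpha> \<le> best_total I n y \<eta>"
  shows "q * \<alpha> - r * C \<le> best_total I (q * n + r) x \<eta>"
  using assms(2)
proof (induction q)
  case 0
  then show ?case using best_total_bounded[of \<eta> C r x, OF C] by simp
next
  case (Suc q)
  have sub: "reach_box I x (q * n + r) \<subseteq> reach_box I x (Suc q * n + r)" by (intro reach_box_mono) simp
  have "best_total I (q * n + r) x \<eta> + \<alpha> \<le> best_total I (q * n + r + n) x \<eta>"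
    using sub Suc.prems by (intro best_total_add_ge) blast
  moreover have "q * \<alpha> - r * C \<le> best_total I (q * n + r) x \<eta>"
    using sub Suc.prems by (intro Suc.IH) blast
  ultimately show ?case by (simp add: algebra_simps)
qed

lemma best_total_measurable:
  assumes "\<And>y i. i \<in> I \<Longrightarrow> (\<lambda>\<omega>. \<eta> \<omega> y i) \<in> borel_measurable M"
  shows "(\<lambda>\<omega>. best_total I n x (\<eta> \<omega>)) \<in> borel_measurable M"
proof (induction n arbitrary: x)
  case (Suc n)
  then show ?case using assms I by (auto intro!: borel_measurable_Max borel_measurable_add)
qed simp

lemma greedy_measurable:
  assumes [measurable]: "\<And>y i. i \<in> I \<Longrightarrow> (\<lambda>\<omega>. \<eta> \<omega> y i) \<in> borel_measurable M"
  shows "(\<lambda>\<omega>. greedy I n x (\<eta> \<omega>)) \<in> M \<rightarrow>\<^sub>M count_space I"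
proof -
  note best_total_measurable[OF assms, measurable]
  define A where "A \<omega> = {i \<in> I. \<forall>j\<in>I. \<eta> \<omega> x j + best_total I (n - 1) (x + j) (\<eta> \<omega>)
      \<le> \<eta> \<omega> x i + best_total I (n - 1) (x + i) (\<eta> \<omega>)}" for \<omega>
  have "A \<in> M \<rightarrow>\<^sub>M count_space (Pow I)"
  proof (subst measurable_count_space_eq2)
    show "A \<in> space M \<rightarrow> Pow I \<and> (\<forall>B\<in>Pow I. A -` {B} \<inter> space M \<in> sets M)"
    proof safe
      fix B assume "B \<subseteq> I"
      have "A -` {B} \<inter> space M = {\<omega> \<in> space M. \<forall>i\<in>I. i \<in> B \<longleftrightarrow> (\<forall>j\<in>I. \<eta> \<omega> x j + best_total I (n - 1) (x + j) (\<eta> \<omega>)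
      \<le> \<eta> \<omega> x i + best_total I (n - 1) (x + i) (\<eta> \<omega>))}"
        using \<open>B \<subseteq> I\<close> unfolding A_def by blast
      also have "\<dots> \<in> sets M"
        using I by measurable
      finally show "A -` {B} \<inter> space M \<in> sets M" .
    qed (auto simp: A_def)
  qed (use I in auto)
  moreover have "(\<lambda>\<omega>. greedy I n x (\<eta> \<omega>)) = (\<lambda>B. SOME i. i \<in> B) \<circ> A"
    by (simp add: fun_eq_iff greedy_def A_def)
  ultimately have "(\<lambda>\<omega>. greedy I n x (\<eta> \<omega>)) \<in> M \<rightarrow>\<^sub>M count_space UNIV"
    by (metis measurable_comp measurable_count_space_extend measurable_count_space subset_UNIV)
  then have "(\<lambda>\<omega>. greedy I n x (\<eta> \<omega>)) -` {i} \<inter> space M \<in> sets M" for i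
    by (rule measurable_sets) simp
  then show ?thesis
    using greedy_in I by (subst measurable_count_space_eq2) auto
qed

end

section \<open>Greedy block strategies\<close>

text \<open>The schedule \<open>r\<close> prescribes the horizon for which the action at time
  \<open>t\<close> is optimised. The countdown \<open>n - t\<close> realises the
  \<open>n\<close>-stage optimum; a schedule of restarting countdowns gives a strategy independent
  of \<open>n\<close>.\<close>

fun greedy_walk :: "(int ^ 'd) set \<Rightarrow> (nat \<Rightarrow> nat) \<Rightarrow> int ^ 'd \<Rightarrow> (int ^ 'd \<Rightarrow> int ^ 'd \<Rightarrow> real) \<Rightarrow> nat \<Rightarrow> int ^ 'd" where
  "greedy_walk I r x \<eta> 0 = x"
| "greedy_walk I r x \<eta> (Suc t) = greedy_walk I r x \<eta> t + greedy I (r t) (greedy_walk I r x \<eta> t) \<eta>"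

definition greedy_sum :: "(int ^ 'd) set \<Rightarrow> (nat \<Rightarrow> nat) \<Rightarrow> int ^ 'd \<Rightarrow> (int ^ 'd \<Rightarrow> int ^ 'd \<Rightarrow> real) \<Rightarrow> nat \<Rightarrow> real" where
  "greedy_sum I r x \<eta> n = (\<Sum>t<n. \<eta> (greedy_walk I r x \<eta> t) (greedy I (r t) (greedy_walk I r x \<eta> t) \<eta>))"

lemma greedy_walk_in_reach_box:
  assumes "finite I" "I \<noteq> {}" shows "greedy_walk I r x \<eta> t \<in> reach_box I x t"
  by (induction t) (auto simp: reach_box_self intro!: reach_box_step greedy_in assms)

text \<open>The schedule \<open>t \<mapsto> (k, r)\<close>: time \<open>t\<close> lies in the block of length \<open>k\<close>, and \<open>r\<close> steps of
  that block remain. Blocks of lengths 1, 2, 3, \<dots> follow each other, so block \<open>k\<close> starts at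
  time \<open>k (k - 1) / 2\<close>.\<close>

fun block :: "nat \<Rightarrow> nat \<times> nat" where
  "block 0 = (1, 1)"
| "block (Suc t) = (if snd (block t) \<le> 1 then (Suc (fst (block t)), Suc (fst (block t)))
     else (fst (block t), snd (block t) - 1))"

text \<open>\<open>t + snd (block t)\<close> is the time at which the current block ends, a
  triangular number.\<close>

lemma block_invariant:
  "0 < snd (block t) \<and> snd (block t) \<le> fst (block t) \<and>
   2 * (t + snd (block t)) = fst (block t) * (fst (block t) + 1)"
  by (induction t) (auto simp: algebra_simps)

text \<open>During block \<open>k\<close> the walk is still in the box of size
  \<open>k\<^sup>2\<close>, which is where the \<open>k\<close>-stage optimum will be under
  control.\<close>

lemma block_start_le: "t \<le> (fst (block t))\<^sup>2"
proof -
  have "2 * t \<le> fst (block t) * (fst (block t) + 1)" "0 < fst (block t)"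
    using block_invariant[of t] by auto
  then show ?thesis
    by (cases "fst (block t)") (auto simp: power2_eq_square)
qed

text \<open>Blocks have length \<open>O(sqrt t)\<close>, so the unfinished one is negligible against
  the elapsed time \<open>t\<close>.\<close>

lemma block_length_le: "real (fst (block t)) \<le> sqrt (2 * real t) + 1"
proof -
  define k where "k = real (fst (block t))"
  have "real (2 * (t + snd (block t))) = real (fst (block t) * (fst (block t) + 1))"
    using block_invariant[of t] by metis
  then have eq: "k * (k + 1) = 2 * (real t + real (snd (block t)))"
    by (simp add: k_def distrib_left)
  have "real (snd (block t)) \<le> k" "1 \<le> k"
    using block_invariant[of t] by (simp_all add: k_def)
  then have "2 * (real t + real (snd (block t))) - 3 * k + 1 \<le> 2 * real t" by (simp add: algebra_simps)
  moreover have "(k - 1)\<^sup>2 = k * (k + 1) - 3 * k + 1"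
    by (simp add: power2_eq_square algebra_simps)
  ultimately have "(k - 1)\<^sup>2 \<le> 2 * real t" unfolding eq by (rule ord_eq_le_trans[rotated])
  then have "k - 1 \<le> sqrt (2 * real t)" by (rule real_le_rsqrt)
  then show ?thesis by (simp add: k_def)
qed

lemma greedy_sum_bounded:
  assumes "finite I" "I \<noteq> {}" "\<And>y i. i \<in> I \<Longrightarrow> \<bar>\<eta> y i\<bar> \<le> C"
  shows "\<bar>greedy_sum I r x \<eta> n\<bar> \<le> n * C"
proof -
  have "\<bar>greedy_sum I r x \<eta> n\<bar> \<le> (\<Sum>t<n. C)"
    unfolding greedy_sum_def by (intro sum_abs[THEN order_trans] sum_mono assms(3) greedy_in assms(1,2))
  then show ?thesis by simp
qed

text \<open>Every step is Bellman-optimal for the steps that remain, so the amount collected plus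
  the remaining optimum stays constant.\<close>

lemma greedy_sum_countdown:
  assumes "finite I" "I \<noteq> {}"
  shows "greedy_sum I (\<lambda>t. n - t) x \<eta> n = best_total I n x \<eta>"
proof -
  let ?r = "\<lambda>t. n - t"
  have "greedy_sum I ?r x \<eta> k + best_total I (n - k) (greedy_walk I ?r x \<eta> k) \<eta> = best_total I n x \<eta>"
    if "k \<le> n" for k
    using that
  proof (induction k)
    case (Suc k)
    then show ?case
      using greedy_opt[OF assms, of "n - k" \<eta> "greedy_walk I ?r x \<eta> k"] by (simp add: greedy_sum_def)
  qed (simp add: greedy_sum_def)
  from this[of n] show ?thesis by simp
qed

text \<open>The quantity bounded below is preserved by a step inside a block; a new block \<open>k\<close> adds
  the \<open>k\<close>-stage optimum at its starting point, which lies in \<open>reach_box I x (k\<^sup>2)\<close>.\<close>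

lemma greedy_sum_block_ge:
  assumes I: "finite I" "I \<noteq> {}" and C: "\<And>y i. i \<in> I \<Longrightarrow> \<bar>\<eta> y i\<bar> \<le> C"
    and good: "\<And>k y. k0 \<le> k \<Longrightarrow> y \<in> reach_box I x (k\<^sup>2) \<Longrightarrow> a * real k \<le> best_total I k y \<eta>"
  defines "r \<equiv> \<lambda>t. snd (block t)"
  shows "a * real (t + r t) - real (k0 * (k0 + 1)) * (\<bar>C\<bar> + \<bar>a\<bar>)
    \<le> greedy_sum I r x \<eta> t + best_total I (r t) (greedy_walk I r x \<eta> t) \<eta>"
proof -
  \<comment> \<open>As long as the block is shorter than \<open>k0\<close>, only the payoff bound is
    available. This phase has \<open>t + r t \<le> k0 * (k0 + 1)\<close>, and each of its stages
    falls short of \<open>a\<close> by at most \<open>\<bar>C\<bar> + \<bar>a\<bar>\<close>.\<close>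
  define D where "D = real (k0 * (k0 + 1)) * (\<bar>C\<bar> + \<bar>a\<bar>)"
  have D: "0 \<le> D" by (simp add: D_def)
  have small: "a * real (t + r t) - D \<le> greedy_sum I r x \<eta> t + best_total I (r t) (greedy_walk I r x \<eta> t) \<eta>"
    if "fst (block t) < k0" for t
  proof -
    have "fst (block t) * (fst (block t) + 1) \<le> k0 * (k0 + 1)"
      using that by (intro mult_mono) auto
    moreover have "2 * (t + r t) = fst (block t) * (fst (block t) + 1)"
      using block_invariant[of t] unfolding r_def by blast
    ultimately have "2 * (t + r t) \<le> k0 * (k0 + 1)" by simp
    then have "t + r t \<le> k0 * (k0 + 1)" by (rule le_trans[rotated]) simp
    then have le: "real (t + r t) \<le> real (k0 * (k0 + 1))" by (rule of_nat_mono)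
    have "- (real t * C) - r t * C \<le> greedy_sum I r x \<eta> t + best_total I (r t) (greedy_walk I r x \<eta> t) \<eta>"
      using greedy_sum_bounded[where \<eta> = \<eta> and r = r and x = x and n = t, OF I C] best_total_bounded[OF I, of \<eta> C "r t" "greedy_walk I r x \<eta> t", OF C]
      by (simp add: abs_le_iff)
    moreover have "(t + r t) * (C + a) \<le> D"
    proof -
      have "(t + r t) * (C + a) \<le> (t + r t) * (\<bar>C\<bar> + \<bar>a\<bar>)"
        by (intro mult_left_mono) auto
      also have "\<dots> \<le> D"
        unfolding D_def by (intro mult_right_mono le) auto
      finally show ?thesis .
    qed
    ultimately show ?thesis by (simp add: algebra_simps)
  qed
  have "a * real (t + r t) - D \<le> greedy_sum I r x \<eta> t + best_total I (r t) (greedy_walk I r x \<eta> t) \<eta>"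
  proof (induction t)
    case 0
    show ?case
    proof (cases "fst (block 0) < k0")
      case False
      then have "a * real 1 \<le> best_total I 1 x \<eta>"
        by (intro good reach_box_self) auto
      with D show ?thesis by (simp add: r_def greedy_sum_def del: best_total.simps)
    qed (rule small)
  next
    case (Suc t)
    have block_step: "greedy_sum I r x \<eta> t + best_total I (r t) (greedy_walk I r x \<eta> t) \<eta>
        = greedy_sum I r x \<eta> (Suc t) + best_total I (r t - 1) (greedy_walk I r x \<eta> (Suc t)) \<eta>"
      using greedy_opt[OF I, of "r t" \<eta> "greedy_walk I r x \<eta> t"] block_invariant[of t]
      by (simp add: greedy_sum_def r_def)
    show ?case
    proof (cases "r t \<le> 1")
      case False
      then have rS: "r (Suc t) = r t - 1" and time: "Suc t + r (Suc t) = t + r t" by (auto simp: r_def)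
      show ?thesis using Suc unfolding time unfolding rS block_step .
    next
      case True
      then have r1: "r t = 1" using block_invariant[of t] by (auto simp: r_def)
      have new: "r (Suc t) = fst (block (Suc t))" using True by (simp add: r_def)
      show ?thesis
      proof (cases "fst (block (Suc t)) < k0")
        case False
        have "greedy_walk I r x \<eta> (Suc t) \<in> reach_box I x ((fst (block (Suc t)))\<^sup>2)"
          using greedy_walk_in_reach_box[OF I] reach_box_mono[OF block_start_le] by blast
        then have "a * r (Suc t) \<le> best_total I (r (Suc t)) (greedy_walk I r x \<eta> (Suc t)) \<eta>"
          unfolding new using False by (intro good) auto
        with Suc block_step r1 show ?thesis by (simp add: algebra_simps)
      qed (rule small)
    qed
  qed
  then show ?thesis by (simp add: D_def)
qed

text \<open>The bound above credits the whole current block in advance. Taking back the part not yet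
  played costs a constant times its length, hence \<open>O(sqrt t)\<close>, and the initial loss is
  constant; both vanish after division by \<open>t\<close>.\<close>

lemma greedy_sum_block_liminf:
  assumes I: "finite I" "I \<noteq> {}" and C: "\<And>y i. i \<in> I \<Longrightarrow> \<bar>\<eta> y i\<bar> \<le> C"
    and good: "\<forall>\<^sub>F k in sequentially. \<forall>y\<in>reach_box I x (k\<^sup>2). a * real k \<le> best_total I k y \<eta>"
    and "0 < \<epsilon>"
  shows "\<forall>\<^sub>F t in sequentially. a - \<epsilon> \<le> greedy_sum I (\<lambda>t. snd (block t)) x \<eta> t / t"
proof -
  define r where "r t = snd (block t)" for t
  obtain k0 where k0: "\<And>k y. k0 \<le> k \<Longrightarrow> y \<in> reach_box I x (k\<^sup>2) \<Longrightarrow> a * real k \<le> best_total I k y \<eta>"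
    using good by (auto simp: eventually_sequentially)
  define D where "D = real (k0 * (k0 + 1)) * (\<bar>C\<bar> + \<bar>a\<bar>)"
  define E where "E = \<bar>C\<bar> + \<bar>a\<bar>"
  have "(\<lambda>t::nat. D / t + (sqrt (2 * real t) + 1) * E / t) \<longlonglongrightarrow> 0" by real_asymp
  then have "\<forall>\<^sub>F t::nat in sequentially. D / t + (sqrt (2 * real t) + 1) * E / t < \<epsilon>"
    by (rule order_tendstoD) fact
  moreover have "\<forall>\<^sub>F t::nat in sequentially. 0 < t" by (rule eventually_gt_at_top)
  ultimately show ?thesis
  proof eventually_elim
    case (elim t)
    have rle: "real (r t) \<le> sqrt (2 * real t) + 1"
      using block_length_le[of t] block_invariant[of t] by (simp add: r_def)
    have "a * real (t + r t) - D \<le> greedy_sum I r x \<eta> t + best_total I (r t) (greedy_walk I r x \<eta> t) \<eta>"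
      using greedy_sum_block_ge[where ?k0.0 = k0 and a = a, OF I C k0] by (simp add: r_def[abs_def] D_def)
    moreover have "best_total I (r t) (greedy_walk I r x \<eta> t) \<eta> \<le> r t * C"
      using best_total_bounded[OF I, of \<eta> C, OF C] abs_le_D1 by blast
    moreover have "r t * C - a * r t \<le> r t * E"
      by (subst mult.commute[of a], subst right_diff_distrib[symmetric]) (auto intro!: mult_left_mono simp: E_def)
    moreover have "r t * E \<le> (sqrt (2 * real t) + 1) * E"
      using rle by (intro mult_right_mono) (auto simp: E_def)
    ultimately have "a * t - (D + (sqrt (2 * real t) + 1) * E) \<le> greedy_sum I r x \<eta> t"
      by (simp add: algebra_simps)
    then have "(a * t - (D + (sqrt (2 * real t) + 1) * E)) / t \<le> greedy_sum I r x \<eta> t / t"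
      by (rule divide_right_mono) simp
    then show ?case using elim by (simp add: diff_divide_distrib add_divide_distrib r_def[abs_def])
  qed
qed

lemma countable_int_vec: "countable (UNIV :: (int ^ 'd) set)"
proof (rule countableI')
  show "inj_on (to_nat \<circ> vec_nth) (UNIV :: (int ^ 'd) set)"
    by (intro comp_inj_on inj_onI) (auto simp: vec_eq_iff)
qed

section \<open>Reduction of the theorem to concentration of the optimal totals\<close>

context pmdp
begin

abbreviation "V n x \<omega> \<equiv> best_total I n x (g \<omega>)"

lemmas actions = finite_actions nonempty_actions

text \<open>Stages are numbered from 1 but walks start at time 0, hence
  \<open>m - 1\<close>.\<close>

definition block_strategy :: "(nat \<Rightarrow> nat) \<Rightarrow> nat \<Rightarrow> 'w \<times> (int ^ 'd) \<Rightarrow> int ^ 'd" where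
  "block_strategy r m = (\<lambda>(\<omega>, z). greedy I (r (m - 1)) (greedy_walk I r z (g \<omega>) (m - 1)) (g \<omega>))"

lemma space_F_all: "space F_all = space M"
  by (simp add: F_all_def space_measure_of_conv)

lemma payoff_measurable_F_all:
  assumes "i \<in> I" shows "(\<lambda>\<omega>. g \<omega> x i) \<in> borel_measurable F_all"
  unfolding F_all_def using assms
  by (intro measurableI) (auto simp: space_measure_of_conv intro!: in_measure_of)

lemma payoff_measurable [measurable]: "i \<in> I \<Longrightarrow> (\<lambda>\<omega>. g \<omega> x i) \<in> borel_measurable M"
  using indep_payoffs by (force simp: indep_vars_def)

lemma V_measurable [measurable]: "(\<lambda>\<omega>. V n x \<omega>) \<in> borel_measurable M"
  by (intro best_total_measurable actions) auto

lemma greedy_walk_measurable: "(\<lambda>\<omega>. greedy_walk I r x (g \<omega>) t) \<in> F_all \<rightarrow>\<^sub>M count_space UNIV"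
proof (induction t)
  case (Suc t)
  show ?case unfolding greedy_walk.simps
  proof (rule measurable_compose_countable'[where f = "\<lambda>y \<omega>. y + greedy I (r t) y (g \<omega>)", OF _ Suc countable_int_vec])
    fix y
    show "(\<lambda>\<omega>. y + greedy I (r t) y (g \<omega>)) \<in> F_all \<rightarrow>\<^sub>M count_space UNIV"
      by (rule measurable_compose[OF greedy_measurable[OF actions payoff_measurable_F_all]]) auto
  qed
qed simp

lemma block_strategy_in: "block_strategy r \<in> strategies"
  unfolding strategies_def
proof safe
  fix m :: nat
  have "(\<lambda>\<omega>. greedy I (r (m - 1)) (greedy_walk I r z (g \<omega>) (m - 1)) (g \<omega>)) \<in> F_all \<rightarrow>\<^sub>M count_space I" for z
    by (rule measurable_compose_countable'[where f = "\<lambda>y \<omega>. greedy I (r (m - 1)) y (g \<omega>)",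
          OF _ greedy_walk_measurable countable_int_vec])
      (rule greedy_measurable[OF actions payoff_measurable_F_all])
  then have "(\<lambda>p. greedy I (r (m - 1)) (greedy_walk I r z (g (fst p)) (m - 1)) (g (fst p)))
      \<in> F_all \<Otimes>\<^sub>M count_space UNIV \<rightarrow>\<^sub>M count_space I" for z
    by (rule measurable_compose[OF measurable_fst])
  from measurable_compose_countable'[where g = snd
      and f = "\<lambda>z p. greedy I (r (m - 1)) (greedy_walk I r z (g (fst p)) (m - 1)) (g (fst p))",
      OF this measurable_snd countable_int_vec]
  show "block_strategy r m \<in> F_all \<Otimes>\<^sub>M count_space UNIV \<rightarrow>\<^sub>M count_space I"
    by (simp add: block_strategy_def case_prod_beta)
qed

lemma play_walk: "play \<sigma> \<omega> z (Suc t) = walk z (\<lambda>t. \<sigma> (Suc t) (\<omega>, z)) t"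
  by (induction t) auto

lemma play_block_strategy: "play (block_strategy r) \<omega> z (Suc t) = greedy_walk I r z (g \<omega>) t"
  by (induction t) (auto simp: block_strategy_def)

lemma payoff_block_strategy: "payoff n z (block_strategy r) \<omega> = greedy_sum I r z (g \<omega>) n / n"
  unfolding payoff_def greedy_sum_def
  by (simp add: play_block_strategy block_strategy_def sum.atLeast1_atMost_eq lessThan_atLeast0 del: play.simps)

text \<open>A strategy sees every payoff, so the maximum over strategies is the optimum over paths
  for each single \<open>\<omega>\<close>; the countdown strategy attains it for all
  \<open>\<omega>\<close> at once.\<close>

lemma stage_value_eq:
  assumes "\<omega> \<in> space M" shows "stage_value n z \<omega> = V n z \<omega> / n"
proof (rule antisym)
  obtain \<sigma> where \<sigma>: "\<sigma> \<in> strategies" "stage_value n z \<omega> = payoff n z \<sigma> \<omega>"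
    using stage_value_attained(1)[OF assms] by blast
  have act: "\<sigma> (Suc m) (\<omega>, z) \<in> I" for m
    using \<sigma>(1) assms measurable_space[of "\<sigma> (Suc m)" "F_all \<Otimes>\<^sub>M count_space UNIV" "count_space I" "(\<omega>, z)"]
    by (auto simp: strategies_def space_pair_measure space_F_all)
  have "payoff n z \<sigma> \<omega> = (\<Sum>t<n. g \<omega> (walk z (\<lambda>t. \<sigma> (Suc t) (\<omega>, z)) t) (\<sigma> (Suc t) (\<omega>, z))) / n"
    unfolding payoff_def
    by (simp add: play_walk sum.atLeast1_atMost_eq lessThan_atLeast0 del: play.simps)
  also have "\<dots> \<le> V n z \<omega> / n"
    by (intro divide_right_mono best_total_ge_walk[OF actions, of n "\<lambda>t. \<sigma> (Suc t) (\<omega>, z)"] act) auto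
  finally show "stage_value n z \<omega> \<le> V n z \<omega> / n" using \<sigma> by simp
  show "V n z \<omega> / n \<le> stage_value n z \<omega>"
    using stage_value_attained(2)[OF assms block_strategy_in, of n z "\<lambda>t. n - t"]
    by (simp add: payoff_block_strategy greedy_sum_countdown actions)
qed

text \<open>The rate \<open>sqrt n\<close> is what both cases deliver: about \<open>sqrt n\<close>
  independent trials for a loop, and deviations of order \<open>n powr (3/4)\<close> around a mean
  otherwise. The constants and the centre \<open>c\<close> do not depend on \<open>x\<close>, which
  serves the union bound and makes the value independent of the initial state.\<close>

definition concentrated :: "real \<Rightarrow> bool" where
  "concentrated c \<longleftrightarrow> (\<forall>\<epsilon>>0. \<exists>K. \<exists>\<kappa>>0. \<forall>\<^sub>F n in sequentially. \<forall>x.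
     prob {\<omega> \<in> space M. \<epsilon> * real n \<le> \<bar>V n x \<omega> - c * real n\<bar>} \<le> K * exp (- \<kappa> * sqrt (real n)))"

lemma concentrated_AE:
  assumes "concentrated c" "0 < \<epsilon>"
  shows "AE \<omega> in M. \<forall>\<^sub>F n in sequentially. \<forall>x\<in>reach_box I z (n\<^sup>2). \<bar>V n x \<omega> - c * real n\<bar> < \<epsilon> * real n"
proof -
  obtain K \<kappa> where \<kappa>: "0 < \<kappa>" and ev: "\<forall>\<^sub>F n in sequentially. \<forall>x.
     prob {\<omega> \<in> space M. \<epsilon> * real n \<le> \<bar>V n x \<omega> - c * real n\<bar>} \<le> K * exp (- \<kappa> * sqrt (real n))"
    using assms by (auto simp: concentrated_def)
  define A where "A n = (\<Union>x\<in>reach_box I z (n\<^sup>2). {\<omega> \<in> space M. \<epsilon> * real n \<le> \<bar>V n x \<omega> - c * real n\<bar>})" for n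
  have fin: "finite (reach_box I z (n\<^sup>2))" for n using finite_actions by (rule finite_reach_box)
  have [measurable]: "A n \<in> sets M" for n
    unfolding A_def using fin by (intro sets.finite_UN) auto
  define d where "d = real (card I)"
  have "\<forall>\<^sub>F n::nat in sequentially. (real n ^ 2 + 1) powr d * (\<bar>K\<bar> * exp (- \<kappa> * sqrt (real n))) \<le> 1 / real n ^ 2"
    using \<kappa> by real_asymp
  with ev have "\<forall>\<^sub>F n in sequentially. norm (prob (A n)) \<le> 1 / real n ^ 2"
  proof eventually_elim
    case (elim n)
    have "prob (A n) \<le> (\<Sum>x\<in>reach_box I z (n\<^sup>2). prob {\<omega> \<in> space M. \<epsilon> * real n \<le> \<bar>V n x \<omega> - c * real n\<bar>})"
      unfolding A_def using fin by (intro finite_measure_subadditive_finite) auto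
    also have "\<dots> \<le> (\<Sum>x\<in>reach_box I z (n\<^sup>2). \<bar>K\<bar> * exp (- \<kappa> * sqrt (real n)))"
      using elim(1) by (intro sum_mono order_trans[OF elim(1)[rule_format]] mult_right_mono) auto
    also have "\<dots> = card (reach_box I z (n\<^sup>2)) * (\<bar>K\<bar> * exp (- \<kappa> * sqrt (real n)))" by simp
    also have "\<dots> \<le> real ((n\<^sup>2 + 1) ^ card I) * (\<bar>K\<bar> * exp (- \<kappa> * sqrt (real n)))"
      by (intro mult_right_mono of_nat_mono card_reach_box_le finite_actions) auto
    also have "real ((n\<^sup>2 + 1) ^ card I) = (real n ^ 2 + 1) powr d"
      unfolding d_def by (subst powr_realpow) (auto simp: add_nonneg_pos add.commute intro: add_pos_nonneg)
    finally show ?case using elim(2) by simp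
  qed
  then have "summable (\<lambda>n. prob (A n))"
    by (rule summable_comparison_test_ev) (use inverse_power_summable[of 2, where 'a = real] in \<open>simp add: field_simps\<close>)
  then have "AE \<omega> in M. \<forall>\<^sub>F n in sequentially. \<omega> \<in> space M - A n"
    by (intro borel_cantelli_AE1) (auto simp: emeasure_eq_measure)
  then show ?thesis
  proof (eventually_elim)
    case (elim \<omega>)
    then show ?case
      by (rule eventually_mono) (auto simp: A_def not_le)
  qed
qed

lemma concentrated_limits:
  assumes "concentrated c"
  shows "AE \<omega> in M. (\<lambda>n. stage_value n z \<omega>) \<longlonglongrightarrow> c \<and> (\<lambda>n. payoff n z (block_strategy (\<lambda>t. snd (block t))) \<omega>) \<longlonglongrightarrow> c"
proof -
  \<comment> \<open>Restricting the tolerance to \<open>1 / (m + 1)\<close> leaves a countable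
    family of events, so one null set serves all tolerances.\<close>
  have "AE \<omega> in M. \<forall>m::nat. \<forall>\<^sub>F n in sequentially.
      \<forall>x\<in>reach_box I z (n\<^sup>2). \<bar>V n x \<omega> - c * real n\<bar> < inverse (real (Suc m)) * real n"
    by (subst AE_all_countable, intro allI concentrated_AE assms) simp
  then show ?thesis
  proof (rule AE_mp, intro AE_I2 impI)
    fix \<omega> assume \<omega>: "\<omega> \<in> space M" and good: "\<forall>m::nat. \<forall>\<^sub>F n in sequentially.
      \<forall>x\<in>reach_box I z (n\<^sup>2). \<bar>V n x \<omega> - c * real n\<bar> < inverse (real (Suc m)) * real n"
    have close: "\<forall>\<^sub>F n in sequentially. \<forall>x\<in>reach_box I z (n\<^sup>2). \<bar>V n x \<omega> - c * real n\<bar> < \<epsilon> * real n" if \<epsilon>: "0 < \<epsilon>" for \<epsilon>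
    proof -
      obtain m where m: "inverse (real (Suc m)) < \<epsilon>" using reals_Archimedean[OF \<epsilon>] by blast
      show ?thesis
        using good[rule_format, of m]
      proof (rule eventually_mono, intro ballI)
        fix n x assume *: "\<forall>x\<in>reach_box I z (n\<^sup>2). \<bar>V n x \<omega> - c * real n\<bar> < inverse (real (Suc m)) * real n" "x \<in> reach_box I z (n\<^sup>2)"
        have "inverse (real (Suc m)) * real n \<le> \<epsilon> * real n" using m by (intro mult_right_mono) auto
        then show "\<bar>V n x \<omega> - c * real n\<bar> < \<epsilon> * real n" using * by fastforce
      qed
    qed
    have conv: "\<forall>\<^sub>F n in sequentially. \<bar>stage_value n z \<omega> - c\<bar> < \<epsilon>" if "0 < \<epsilon>" for \<epsilon>
      using close[OF that] eventually_gt_at_top[of 0]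
    proof eventually_elim
      case (elim n)
      have "\<bar>V n z \<omega> - c * real n\<bar> < \<epsilon> * real n"
        using elim(1) reach_box_self[of z I "n\<^sup>2"] by blast
      moreover have "stage_value n z \<omega> - c = (V n z \<omega> - c * real n) / real n"
        using elim(2) \<omega> by (simp add: stage_value_eq field_simps)
      ultimately show ?case using elim(2) by (simp add: abs_divide divide_less_eq)
    qed
    obtain C where C: "\<And>y i. i \<in> I \<Longrightarrow> \<bar>g \<omega> y i\<bar> \<le> C"
      using bounded_payoffs \<omega> by blast
    \<comment> \<open>Only the lower bound needs the blocks; the upper bound comes from
      \<open>payoff \<le> stage_value\<close> and the convergence of the stage values.\<close>
    have "(\<lambda>n. payoff n z (block_strategy (\<lambda>t. snd (block t))) \<omega>) \<longlonglongrightarrow> c"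
    proof (rule tendstoI)
      fix \<epsilon> :: real assume \<epsilon>: "0 < \<epsilon>"
      have "\<forall>\<^sub>F k in sequentially. \<forall>y\<in>reach_box I z (k\<^sup>2). (c - \<epsilon> / 3) * real k \<le> V k y \<omega>"
      proof (rule eventually_mono[OF close[of "\<epsilon> / 3"]], use \<epsilon> in simp, rule ballI)
        fix k y assume "\<forall>x\<in>reach_box I z (k\<^sup>2). \<bar>V k x \<omega> - c * real k\<bar> < \<epsilon> / 3 * real k" "y \<in> reach_box I z (k\<^sup>2)"
        then have "\<bar>V k y \<omega> - c * real k\<bar> < \<epsilon> / 3 * real k" by blast
        then show "(c - \<epsilon> / 3) * real k \<le> V k y \<omega>" unfolding left_diff_distrib by linarith
      qed
      from greedy_sum_block_liminf[OF actions C this, of "\<epsilon> / 3"] \<epsilon>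
      have "\<forall>\<^sub>F t in sequentially. c - \<epsilon> / 3 - \<epsilon> / 3 \<le> payoff t z (block_strategy (\<lambda>t. snd (block t))) \<omega>"
        by (simp add: payoff_block_strategy)
      moreover have "\<forall>\<^sub>F t in sequentially. \<bar>stage_value t z \<omega> - c\<bar> < \<epsilon>" by (rule conv) fact
      ultimately show "\<forall>\<^sub>F n in sequentially. dist (payoff n z (block_strategy (\<lambda>t. snd (block t))) \<omega>) c < \<epsilon>"
      proof eventually_elim
        case (elim t)
        then show ?case
          using stage_value_attained(2)[OF \<omega> block_strategy_in, of t z "\<lambda>t. snd (block t)"] \<epsilon>
          by (auto simp: dist_real_def)
      qed
    qed
    moreover have "(\<lambda>n. stage_value n z \<omega>) \<longlonglongrightarrow> c"
      using conv by (intro tendstoI) (auto simp: dist_real_def)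
    ultimately show "(\<lambda>n. stage_value n z \<omega>) \<longlonglongrightarrow> c \<and> (\<lambda>n. payoff n z (block_strategy (\<lambda>t. snd (block t))) \<omega>) \<longlonglongrightarrow> c"
      by blast
  qed
qed

end

section \<open>Loops and separating functionals\<close>

definition real_vec :: "int ^ 'd \<Rightarrow> real ^ 'd" where
  "real_vec x = (\<chi> j. real_of_int (x $ j))"

lemma real_vec_add: "real_vec (x + y) = real_vec x + real_vec y"
  by (simp add: real_vec_def vec_eq_iff)

text \<open>The convex weights may be irrational. Rounding their multiples by a common denominator
  \<open>q\<close> gives multiplicities \<open>m i\<close> for which the sum of the
  \<open>m i *s i\<close> has norm below 1; being integral, it is exactly 0.\<close>

lemma convex_combination_zero_imp_loop:
  fixes I :: "(int ^ 'd) set"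
  assumes "finite I" and zero: "0 \<in> convex hull (real_vec ` I)"
  obtains w where "w \<noteq> []" "set w \<subseteq> I" "sum_list w = 0"
proof -
  have inj: "inj_on real_vec I" by (auto simp: inj_on_def real_vec_def vec_eq_iff)
  obtain u where u: "\<And>v. v \<in> real_vec ` I \<Longrightarrow> 0 \<le> u v" "sum u (real_vec ` I) = 1"
      "(\<Sum>v\<in>real_vec ` I. u v *\<^sub>R v) = 0"
    using zero \<open>finite I\<close> by (auto simp: convex_hull_finite)
  define l where "l i = u (real_vec i)" for i
  have l: "\<And>i. i \<in> I \<Longrightarrow> 0 \<le> l i" "sum l I = 1" "(\<Sum>i\<in>I. l i *\<^sub>R real_vec i) = 0"
    using u by (simp_all add: l_def sum.reindex[OF inj])
  then have "I \<noteq> {}" by auto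
  have "\<exists>i\<in>I. 0 < l i"
    using l(1,2) by (metis less_eq_real_def sum.neutral zero_neq_one)
  then obtain i0 where i0: "i0 \<in> I" "0 < l i0" by blast
  obtain e where e: "bij_betw e {..<card I} I"
    using ex_bij_betw_nat_finite[OF \<open>finite I\<close>] by (auto simp: lessThan_atLeast0)
  define S where "S = (\<Sum>i\<in>I. norm (real_vec i))"
  \<comment> \<open>\<open>N > S\<close> makes the rounding error of the vector smaller than 1;
    \<open>N > 1 / l i0\<close> keeps \<open>m i0\<close> positive, so that the loop is not
    empty.\<close>
  obtain N :: nat where N: "0 < N" "1 / l i0 + S + 1 < N"
  proof -
    obtain N :: nat where "1 / l i0 + S + 1 < N" using reals_Archimedean2 by blast
    moreover have "0 \<le> 1 / l i0 + S" using i0 by (auto simp: S_def intro!: add_nonneg_nonneg sum_nonneg)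
    ultimately show ?thesis by (intro that[of N]) (auto intro: gr0I)
  qed
  have S: "0 \<le> S" by (auto simp: S_def intro: sum_nonneg)
  obtain q p where q: "0 < q" and p: "\<And>k. k < card I \<Longrightarrow> \<bar>of_int q * l (e k) - of_int (p k)\<bar> < 1 / N"
    using Dirichlet_approx_simult[OF N(1), of "card I" "\<lambda>k. l (e k)"] by metis
  define m where "m i = p (inv_into {..<card I} e i)" for i
  have m: "\<bar>of_int q * l i - of_int (m i)\<bar> < 1 / N" if "i \<in> I" for i
  proof -
    have "inv_into {..<card I} e i < card I" "e (inv_into {..<card I} e i) = i"
      using that e by (auto simp: bij_betw_def intro: f_inv_into_f) (metis inv_into_into lessThan_iff)
    then show ?thesis using p unfolding m_def by metis
  qed
  have N1: "1 / N \<le> 1" using N by simp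
  have m_nonneg: "0 \<le> m i" if "i \<in> I" for i
  proof -
    have "0 \<le> of_int q * l i" using l(1)[OF that] q by simp
    then have "-1 < real_of_int (m i)" using m[OF that] N1 by linarith
    then show ?thesis by linarith
  qed
  have "0 < m i0"
  proof -
    have "1 / N < l i0" using N i0 S by (simp add: field_simps) (smt (verit) mult_nonneg_nonneg)
    also have "\<dots> \<le> of_int q * l i0" using q i0 by simp
    finally have "0 < real_of_int (m i0)" using m[OF i0(1)] by linarith
    then show ?thesis by simp
  qed
  have "norm (\<Sum>i\<in>I. of_int (m i) *\<^sub>R real_vec i) < 1"
  proof -
    have "(\<Sum>i\<in>I. of_int (m i) *\<^sub>R real_vec i) = (\<Sum>i\<in>I. of_int (m i) *\<^sub>R real_vec i) - of_int q *\<^sub>R (\<Sum>i\<in>I. l i *\<^sub>R real_vec i)"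
      using l by simp
    also have "\<dots> = (\<Sum>i\<in>I. (of_int (m i) - of_int q * l i) *\<^sub>R real_vec i)"
      by (simp add: scaleR_sum_right scaleR_left_diff_distrib sum_subtractf)
    also have "norm \<dots> \<le> (\<Sum>i\<in>I. \<bar>of_int (m i) - of_int q * l i\<bar> * norm (real_vec i))"
      by (rule norm_sum[THEN order_trans]) simp
    also have "\<dots> \<le> (\<Sum>i\<in>I. 1 / N * norm (real_vec i))"
      using m by (intro sum_mono mult_right_mono) (auto simp: abs_minus_commute less_imp_le)
    also have "\<dots> = S / N" by (simp add: S_def sum_divide_distrib)
    also have "\<dots> < 1"
    proof -
      have "0 < 1 / l i0" using i0 by simp
      then have "S < N" using N(2) by linarith
      then show ?thesis using N(1) by simp
    qed
    finally show ?thesis .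
  qed
  moreover have "(\<Sum>i\<in>I. of_int (m i) *\<^sub>R real_vec i) = real_vec (\<Sum>i\<in>I. m i *s i)"
    by (simp add: real_vec_def vec_eq_iff)
  ultimately have lt: "norm (real_vec (\<Sum>i\<in>I. m i *s i)) < 1" by simp
  have zero: "(\<Sum>i\<in>I. m i *s i) = 0"
  proof (rule vec_eq_iff[THEN iffD2], rule allI)
    fix j
    have "\<bar>real_vec (\<Sum>i\<in>I. m i *s i) $ j\<bar> < 1"
      using component_le_norm_cart lt by (rule le_less_trans)
    then have "\<bar>(\<Sum>i\<in>I. m i *s i) $ j\<bar> < 1"
      by (simp only: real_vec_def vec_lambda_beta)
    then show "(\<Sum>i\<in>I. m i *s i) $ j = 0 $ j" by simp
  qed
  obtain xs where xs: "set xs = I" "distinct xs"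
    using finite_distinct_list[OF \<open>finite I\<close>] by blast
  define w where "w = concat (map (\<lambda>i. replicate (nat (m i)) i) xs)"
  have rep: "sum_list (replicate k i) = int k *s i" for k and i :: "int ^ 'd"
    by (induction k) (simp_all add: vec_eq_iff algebra_simps)
  show thesis
  proof
    have "sum_list w = (\<Sum>i\<leftarrow>xs. sum_list (replicate (nat (m i)) i))"
      unfolding w_def by (induction xs) auto
    also have "\<dots> = (\<Sum>i\<in>I. int (nat (m i)) *s i)"
      using xs by (simp add: rep sum_list_distinct_conv_sum_set)
    also have "\<dots> = 0" using m_nonneg zero by simp
    finally show "sum_list w = 0" .
    show "set w \<subseteq> I" using xs by (auto simp: w_def)
    show "w \<noteq> []" using i0(1) \<open>0 < m i0\<close> xs(1) by (auto simp: w_def intro!: bexI[of _ i0])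
  qed
qed

text \<open>Strict separation of 0 from a compact convex set, scaled so that the gap is 1: then
  every step raises the integer part of the functional.\<close>

lemma separating_functional:
  fixes I :: "(int ^ 'd) set"
  assumes "finite I" "0 \<notin> convex hull (real_vec ` I)"
  obtains \<phi> :: "int ^ 'd \<Rightarrow> real" where "\<And>x y. \<phi> (x + y) = \<phi> x + \<phi> y" "\<And>i. i \<in> I \<Longrightarrow> 1 \<le> \<phi> i"
proof -
  have "closed (convex hull (real_vec ` I))"
    using assms by (intro compact_imp_closed finite_imp_compact_convex_hull) auto
  with assms(2) obtain a b where ab: "0 < b" "\<And>v. v \<in> convex hull (real_vec ` I) \<Longrightarrow> b < a \<bullet> v"
    using separating_hyperplane_closed_0[OF convex_convex_hull] by metis
  show thesis
  proof (rule that[of "\<lambda>x. a \<bullet> real_vec x / b"])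
    show "1 \<le> a \<bullet> real_vec i / b" if "i \<in> I" for i
      using ab(1) ab(2)[OF hull_inc[of "real_vec i"]] that by simp
  qed (simp add: real_vec_add inner_add_right add_divide_distrib)
qed

section \<open>Action sets with a loop\<close>

text \<open>Repeating \<open>w\<close> periodically keeps reusing the payoffs of a single copy of
  the loop, because the position depends only on the time modulo \<open>length w\<close>.\<close>

lemma best_total_ge_loop:
  assumes I: "finite I" "I \<noteq> {}" and w: "w \<noteq> []" "set w \<subseteq> I" "sum_list w = 0"
    and good: "\<And>s. s < length w \<Longrightarrow> b \<le> \<eta> (x + sum_list (take s w)) (w ! s)"
  shows "n * b \<le> best_total I n x \<eta>"
proof -
  define l where "l = length w"
  have l: "0 < l" using w by (simp add: l_def)
  define a where "a s = w ! (s mod l)" for s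
  have walk: "walk x a s = x + sum_list (take (s mod l) w)" for s
  proof (induction s)
    case (Suc s)
    have lt: "s mod l < length w" using l by (simp add: l_def)
    have "sum_list (take (s mod l) w) + w ! (s mod l) = sum_list (take (Suc (s mod l)) w)"
      using lt by (simp add: take_Suc_conv_app_nth)
    also have "\<dots> = sum_list (take (Suc s mod l) w)"
      using w(3) by (auto simp: mod_Suc l_def)
    finally show ?case using Suc by (simp add: a_def add.assoc)
  qed simp
  have "n * b = (\<Sum>s<n. b)" by simp
  also have "\<dots> \<le> (\<Sum>s<n. \<eta> (walk x a s) (a s))"
    unfolding walk a_def using good l by (intro sum_mono) (simp add: l_def)
  also have "\<dots> \<le> best_total I n x \<eta>"
    using w l by (intro best_total_ge_walk I) (auto simp: a_def l_def intro!: subsetD[OF w(2)])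
  finally show ?thesis .
qed

text \<open>The price of walking to a distant copy of the loop: at most \<open>C\<close> per
  step.\<close>

lemma best_total_ge_straight:
  assumes I: "finite I" "I \<noteq> {}" and C: "\<And>y i. i \<in> I \<Longrightarrow> \<bar>\<eta> y i\<bar> \<le> C" and i: "i \<in> I"
  shows "best_total I n (x + int k *s i) \<eta> - k * C \<le> best_total I (k + n) x \<eta>"
proof (induction k arbitrary: x)
  case (Suc k)
  have "x + int (Suc k) *s i = (x + i) + int k *s i"
    by (simp add: vec_eq_iff algebra_simps)
  then have "best_total I n (x + int (Suc k) *s i) \<eta> - k * C \<le> best_total I (k + n) (x + i) \<eta>"
    using Suc[of "x + i"] by (simp add: add.assoc)
  also have "\<dots> \<le> best_total I (Suc (k + n)) x \<eta> - \<eta> x i"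
    using best_total_ge[OF I i, of \<eta> x "k + n"] by simp
  also have "\<dots> \<le> best_total I (Suc (k + n)) x \<eta> + C"
    using C[OF i, of x] by linarith
  finally show ?case by (simp add: algebra_simps del: best_total.simps)
qed simp

context pmdp
begin

lemma prob_payoff_eq:
  assumes "i \<in> I" "j \<in> I" "B \<in> sets borel"
  shows "prob {\<omega> \<in> space M. g \<omega> x i \<in> B} = prob {\<omega> \<in> space M. g \<omega> y j \<in> B}"
proof -
  have law: "prob {\<omega> \<in> space M. g \<omega> x i \<in> B} = measure (distr M borel (\<lambda>\<omega>. g \<omega> x i)) B" if "i \<in> I" for x i
    using that assms(3) by (subst measure_distr) (auto simp: vimage_def Int_def conj_commute)
  show ?thesis
    unfolding law[OF assms(1)] law[OF assms(2)]
    by (simp only: identically_distributed_payoffs[OF assms(1,2), of x y])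
qed

text \<open>Equal laws make one threshold and one probability \<open>p\<close> valid at every site;
  countability of the lattice yields a single null set for the upper bound.\<close>

lemma essential_supremum_ex:
  obtains c where "AE \<omega> in M. \<forall>x. \<forall>i\<in>I. g \<omega> x i \<le> c"
    and "\<And>t. t < c \<Longrightarrow> \<exists>p>0. \<forall>x. \<forall>i\<in>I. prob {\<omega> \<in> space M. t < g \<omega> x i} = p"
proof -
  obtain i0 where i0: "i0 \<in> I" using nonempty_actions by blast
  obtain C where C: "\<And>\<omega> x i. \<omega> \<in> space M \<Longrightarrow> i \<in> I \<Longrightarrow> \<bar>g \<omega> x i\<bar> \<le> C"
    using bounded_payoffs by blast
  define T where "T = {t. 0 < prob {\<omega> \<in> space M. t < g \<omega> 0 i0}}"
  have eq: "prob {\<omega> \<in> space M. t < g \<omega> x i} = prob {\<omega> \<in> space M. t < g \<omega> 0 i0}" if "i \<in> I" for t x i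
    using prob_payoff_eq[OF that i0, of "{t<..}"] by simp
  have "- C - 1 \<in> T"
  proof -
    have "{\<omega> \<in> space M. - C - 1 < g \<omega> 0 i0} = space M"
      using C[OF _ i0, of _ 0] by (force simp: abs_le_iff)
    then show ?thesis by (simp add: T_def prob_space)
  qed
  moreover have ub: "t \<le> C" if "t \<in> T" for t
  proof (rule ccontr)
    assume "\<not> t \<le> C"
    then have "{\<omega> \<in> space M. t < g \<omega> 0 i0} = {}"
      using C[OF _ i0, of _ 0] by (force simp: abs_le_iff)
    with that show False by (simp only: T_def mem_Collect_eq measure_empty)
  qed
  ultimately have T: "T \<noteq> {}" "bdd_above T" by (auto intro: bdd_aboveI[of _ C])
  show thesis
  proof (rule that[of "Sup T"])
    fix t assume "t < Sup T"
    then obtain s where s: "s \<in> T" "t < s" using less_cSup_iff[OF T] by blast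
    have "0 < prob {\<omega> \<in> space M. s < g \<omega> 0 i0}" using s by (simp add: T_def)
    also have "\<dots> \<le> prob {\<omega> \<in> space M. t < g \<omega> 0 i0}"
      using s i0 by (intro finite_measure_mono) auto
    finally show "\<exists>p>0. \<forall>x. \<forall>i\<in>I. prob {\<omega> \<in> space M. t < g \<omega> x i} = p"
      using eq by blast
  next
    have approx: "AE \<omega> in M. \<forall>m::nat. g \<omega> x i \<le> Sup T + inverse (real (Suc m))" if "i \<in> I" for x i
    proof (subst AE_all_countable, rule allI)
      fix m :: nat
      have "Sup T + inverse (real (Suc m)) \<notin> T"
        using cSup_upper[OF _ T(2), of "Sup T + inverse (real (Suc m))"] by auto
      then have "prob {\<omega> \<in> space M. Sup T + inverse (real (Suc m)) < g \<omega> x i} = 0"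
        unfolding T_def eq[OF that] using measure_nonneg[of M] by (simp add: less_le)
      then show "AE \<omega> in M. g \<omega> x i \<le> Sup T + inverse (real (Suc m))"
        using that by (subst (asm) prob_eq_0) (auto elim!: eventually_mono simp: not_less)
    qed
    have "AE \<omega> in M. g \<omega> x i \<le> Sup T" if "i \<in> I" for x i
    proof (rule AE_mp[OF approx[OF that, of x]], intro AE_I2 impI)
      fix \<omega> assume *: "\<forall>m::nat. g \<omega> x i \<le> Sup T + inverse (real (Suc m))"
      show "g \<omega> x i \<le> Sup T"
      proof (rule field_le_epsilon)
        fix e :: real assume "0 < e"
        then obtain m where "inverse (real (Suc m)) < e" using reals_Archimedean by blast
        with spec[OF *, of m] show "g \<omega> x i \<le> Sup T + e" by linarith
      qed
    qed
    then have "AE \<omega> in M. \<forall>i\<in>I. g \<omega> x i \<le> Sup T" for x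
      by (simp add: AE_ball_countable[OF countable_finite[OF finite_actions]])
    then have "AE \<omega> in M. \<forall>x\<in>UNIV. \<forall>i\<in>I. g \<omega> x i \<le> Sup T"
      by (simp only: AE_ball_countable[OF countable_int_vec]) simp
    then show "AE \<omega> in M. \<forall>x. \<forall>i\<in>I. g \<omega> x i \<le> Sup T" by simp
  qed
qed

text \<open>Each edge set is entirely above \<open>t\<close> with probability at least
  \<open>p ^ l\<close>, and disjoint sets are independent. So all \<open>J\<close> of them fail with
  probability at most \<open>(1 - p ^ l) ^ J\<close>.\<close>

lemma prob_no_good_edge_set_le:
  fixes J :: nat
  assumes p: "0 < p" "\<And>x i. i \<in> I \<Longrightarrow> prob {\<omega> \<in> space M. t < g \<omega> x i} = p"
    and E: "\<And>j. j < J \<Longrightarrow> E j \<subseteq> UNIV \<times> I" "\<And>j. j < J \<Longrightarrow> finite (E j)" "\<And>j. j < J \<Longrightarrow> card (E j) \<le> l"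
    and disj: "disjoint_family_on E {..<J}"
  shows "prob {\<omega> \<in> space M. \<forall>j<J. \<exists>(x, i)\<in>E j. g \<omega> x i \<le> t} \<le> exp (- (p ^ l) * real J)"
proof (cases "J = 0")
  case True
  then show ?thesis by (simp add: prob_space)
next
  case False
  define X where "X = (\<lambda>(x, i) \<omega>. g \<omega> x i)"
  have p1: "p \<le> 1" using p(2) nonempty_actions prob_le_1 by (metis all_not_in_conv)
  have X_indep: "indep_vars (\<lambda>_. borel) X (UNIV \<times> I)"
    using indep_payoffs by (simp add: X_def)
  have Xrv [measurable]: "X e \<in> borel_measurable M" if "e \<in> UNIV \<times> I" for e
    using that by (auto simp: X_def)
  define A where "A j = {u \<in> space (PiM (E j) (\<lambda>_. borel)). \<exists>e\<in>E j. u e \<le> t}" for j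
  have meas: "A j \<in> sets (PiM (E j) (\<lambda>_. borel :: real measure))" if "j < J" for j
    unfolding A_def using E(2)[OF that] by measurable
  have indep: "indep_vars (\<lambda>j. PiM (E j) (\<lambda>_. borel)) (\<lambda>j \<omega>. restrict (\<lambda>e. X e \<omega>) (E j)) {..<J}"
    using E disj by (intro indep_vars_restrict[OF X_indep]) auto
  have pre: "(\<lambda>\<omega>. restrict (\<lambda>e. X e \<omega>) (E j)) -` A j \<inter> space M = {\<omega> \<in> space M. \<exists>e\<in>E j. X e \<omega> \<le> t}" for j
    by (auto simp: A_def space_PiM)
  have one: "prob {\<omega> \<in> space M. \<exists>e\<in>E j. X e \<omega> \<le> t} \<le> 1 - p ^ l" if j: "j < J" for j
  proof (cases "E j = {}")
    case True
    then show ?thesis using p p1 by (simp add: power_le_one)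
  next
    case False
    have ev: "{\<omega> \<in> space M. \<exists>e\<in>E j. X e \<omega> \<le> t} \<in> events"
      using E(1,2)[OF j] by (intro sets.sets_Collect_finite_Ex) auto
    have "p ^ l \<le> p ^ card (E j)"
      using E(3)[OF j] p p1 by (intro power_decreasing) auto
    also have "\<dots> = (\<Prod>e\<in>E j. prob (X e -` {t<..} \<inter> space M))"
    proof (subst prod_constant[symmetric], rule prod.cong[OF refl])
      fix e assume "e \<in> E j"
      then show "p = prob (X e -` {t<..} \<inter> space M)"
        using E(1)[OF j] p(2)[of "snd e" "fst e"] by (auto simp: X_def vimage_def Int_def conj_commute split: prod.splits)
    qed
    also have "\<dots> = prob (\<Inter>e\<in>E j. X e -` {t<..} \<inter> space M)"
      using False E[OF j] by (intro indep_varsD[OF X_indep, symmetric]) auto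
    also have "(\<Inter>e\<in>E j. X e -` {t<..} \<inter> space M) = space M - {\<omega> \<in> space M. \<exists>e\<in>E j. X e \<omega> \<le> t}"
      using False by (auto simp: not_le)
    also have "prob \<dots> = 1 - prob {\<omega> \<in> space M. \<exists>e\<in>E j. X e \<omega> \<le> t}"
      by (rule prob_compl[OF ev])
    finally show ?thesis by simp
  qed
  have "{\<omega> \<in> space M. \<forall>j<J. \<exists>(x, i)\<in>E j. g \<omega> x i \<le> t} = (\<Inter>j\<in>{..<J}. {\<omega> \<in> space M. \<exists>e\<in>E j. X e \<omega> \<le> t})"
    using False by (fastforce simp: X_def case_prod_beta)
  also have "prob \<dots> = (\<Prod>j<J. prob {\<omega> \<in> space M. \<exists>e\<in>E j. X e \<omega> \<le> t})"
    using indep_varsD_finite[OF indep, of A] meas False by (simp add: pre lessThan_empty_iff)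
  also have "\<dots> \<le> (\<Prod>j<J. exp (- (p ^ l)))"
    using one exp_ge_add_one_self[of "- (p ^ l)"] by (intro prod_mono) force
  also have "\<dots> = exp (- (p ^ l) * real J)" by (simp add: exp_of_nat_mult[symmetric] mult.commute)
  finally show ?thesis .
qed

text \<open>With a closed loop among the actions, the essential supremum \<open>c\<close> of the payoffs is the
  value: walk along a nonzero action and go round forever in the first copy of the loop all of
  whose payoffs are close to \<open>c\<close>; far apart copies are independent.\<close>

lemma loop_imp_concentrated:
  assumes w: "w \<noteq> []" "set w \<subseteq> I" "sum_list w = 0" and i0: "i0 \<in> I" "i0 \<noteq> 0"
  shows "\<exists>c. concentrated c"
proof -
  obtain c where c: "AE \<omega> in M. \<forall>x. \<forall>i\<in>I. g \<omega> x i \<le> c"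
    and pos: "\<And>t. t < c \<Longrightarrow> \<exists>p>0. \<forall>x. \<forall>i\<in>I. prob {\<omega> \<in> space M. t < g \<omega> x i} = p"
    using essential_supremum_ex by blast
  obtain C where C: "\<And>\<omega> x i. \<omega> \<in> space M \<Longrightarrow> i \<in> I \<Longrightarrow> \<bar>g \<omega> x i\<bar> \<le> C"
    using bounded_payoffs by blast
  define l where "l = length w"
  define P where "P s = sum_list (take s w)" for s
  obtain k where k: "i0 $ k \<noteq> 0" using i0 by (auto simp: vec_eq_iff)
  \<comment> \<open>\<open>S\<close> exceeds the spread of the loop in coordinate \<open>k\<close>,
    in which \<open>i0\<close> moves. Copies shifted by different multiples of \<open>S\<close>
    times \<open>i0\<close> therefore share no edge.\<close>
  obtain S :: nat where S: "\<And>s s'. s < l \<Longrightarrow> s' < l \<Longrightarrow> \<bar>P s $ k - P s' $ k\<bar> < int S"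
  proof
    fix s s' assume "s < l" "s' < l"
    then have "\<bar>P s $ k - P s' $ k\<bar> \<le> (\<Sum>s<l. \<Sum>s'<l. \<bar>P s $ k - P s' $ k\<bar>)"
      by (intro order_trans[OF member_le_sum[of s' "{..<l}" "\<lambda>s'. \<bar>P s $ k - P s' $ k\<bar>"]]
          member_le_sum[of s "{..<l}" "\<lambda>s. \<Sum>s'<l. \<bar>P s $ k - P s' $ k\<bar>"]) (auto intro: sum_nonneg)
    then show "\<bar>P s $ k - P s' $ k\<bar> < int (Suc (nat (\<Sum>s<l. \<Sum>s'<l. \<bar>P s $ k - P s' $ k\<bar>)))"
      by linarith
  qed
  define E where "E x j = (\<lambda>s. (x + int (j * S) *s i0 + P s, w ! s)) ` {..<l}" for x and j :: nat
  have E: "E x j \<subseteq> UNIV \<times> I" "finite (E x j)" "card (E x j) \<le> l" for x j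
    using w by (auto simp: E_def l_def intro: order_trans[OF card_image_le])
  have disj: "disjoint_family_on (E x) B" for x B
    unfolding disjoint_family_on_def
  proof (intro ballI impI, rule ccontr)
    fix j j' assume "j \<noteq> j'" and "E x j \<inter> E x j' \<noteq> {}"
    then obtain s s' where s: "s < l" "s' < l" "x + int (j * S) *s i0 + P s = x + int (j' * S) *s i0 + P s'"
      by (force simp: E_def)
    have "P s $ k - P s' $ k = (int j' - int j) * (int S * i0 $ k)"
      using arg_cong[OF s(3), of "\<lambda>v. v $ k"] by (simp add: algebra_simps)
    then have "\<bar>P s $ k - P s' $ k\<bar> = \<bar>int j' - int j\<bar> * (int S * \<bar>i0 $ k\<bar>)"
      by (simp add: abs_mult)
    moreover have "1 * (int S * 1) \<le> \<bar>int j' - int j\<bar> * (int S * \<bar>i0 $ k\<bar>)"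
      using \<open>j \<noteq> j'\<close> k by (intro mult_mono) auto
    ultimately show False using S[OF s(1,2)] by simp
  qed
  have "concentrated c"
    unfolding concentrated_def
  proof (intro allI impI)
    fix \<epsilon> :: real assume \<epsilon>: "0 < \<epsilon>"
    \<comment> \<open>One half of \<open>\<epsilon>\<close> is spent on the payoffs along the loop,
      the other half on the way to it.\<close>
    define t where "t = c - \<epsilon> / 2"
    obtain p where p: "0 < p" "\<And>x i. i \<in> I \<Longrightarrow> prob {\<omega> \<in> space M. t < g \<omega> x i} = p"
      using pos[of t] \<epsilon> by (auto simp: t_def)
    define D where "D = real S * (\<bar>C\<bar> + \<bar>t\<bar>)"
    have "\<forall>\<^sub>F n::nat in sequentially. sqrt (real n) * D < \<epsilon> / 2 * real n"
      using \<epsilon> by real_asymp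
    moreover have "\<forall>\<^sub>F n::nat in sequentially. sqrt (real n) * real S \<le> real n"
      by real_asymp
    moreover have "\<forall>\<^sub>F n::nat in sequentially. 0 < n" by (rule eventually_gt_at_top)
    ultimately have "\<forall>\<^sub>F n::nat in sequentially. \<forall>x. prob {\<omega> \<in> space M. \<epsilon> * real n \<le> \<bar>V n x \<omega> - c * real n\<bar>}
      \<le> exp (p ^ l) * exp (- (p ^ l) * sqrt (real n))"
    proof eventually_elim
      case (elim n)
      show ?case
      proof
        fix x
        \<comment> \<open>About \<open>sqrt n\<close> trials: enough for a failure probability
          \<open>exp (- (p ^ l) * sqrt n)\<close> up to a factor \<open>exp (p ^ l)\<close> for
          rounding, yet few enough that walking to the last copy takes \<open>o(n)\<close>
          steps.\<close>
        define J where "J = nat \<lfloor>sqrt (real n)\<rfloor>"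
        have J: "real J \<le> sqrt (real n)" "sqrt (real n) - 1 \<le> real J"
          by (auto simp: J_def)
        have good: "V n x \<omega> > (c - \<epsilon>) * real n"
          if \<omega>: "\<omega> \<in> space M" and j: "j < J" and "\<forall>(y, i)\<in>E x j. t < g \<omega> y i" for \<omega> j
        proof -
          have jS: "real (j * S) \<le> sqrt (real n) * real S"
            using j J(1) by (simp add: mult_right_mono)
          then have le: "j * S \<le> n" using elim(2) by linarith
          have "(n - j * S) * t \<le> V (n - j * S) (x + int (j * S) *s i0) \<omega>"
          proof (rule best_total_ge_loop[OF actions w])
            fix s assume "s < length w"
            then show "t \<le> g \<omega> (x + int (j * S) *s i0 + sum_list (take s w)) (w ! s)"
              using that(3) by (force simp: E_def P_def l_def)
          qed
          then have "(n - j * S) * t - (j * S) * C \<le> V n x \<omega>"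
            using best_total_ge_straight[where n = "n - j * S" and x = x and k = "j * S" and \<eta> = "g \<omega>", OF actions C[OF \<omega>] i0(1)] le
            by simp
          moreover have "(n - j * S) * t - (j * S) * C = n * t - (j * S) * (C + t)"
            using le by (simp add: of_nat_diff algebra_simps)
          moreover have "(j * S) * (C + t) \<le> (j * S) * (\<bar>C\<bar> + \<bar>t\<bar>)"
            by (intro mult_left_mono) auto
          moreover have "(j * S) * (\<bar>C\<bar> + \<bar>t\<bar>) \<le> sqrt (real n) * D"
            unfolding D_def mult.assoc[symmetric] using jS by (intro mult_right_mono) auto
          ultimately have "n * t - \<epsilon> / 2 * real n < V n x \<omega>" using elim(1) by linarith
          then show ?thesis by (simp add: t_def algebra_simps)
        qed
        have "prob {\<omega> \<in> space M. \<epsilon> * real n \<le> \<bar>V n x \<omega> - c * real n\<bar>}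
            \<le> prob {\<omega> \<in> space M. \<forall>j<J. \<exists>(y, i)\<in>E x j. g \<omega> y i \<le> t}"
        proof (rule finite_measure_mono_AE)
          show "AE \<omega> in M. \<omega> \<in> {\<omega> \<in> space M. \<epsilon> * real n \<le> \<bar>V n x \<omega> - c * real n\<bar>} \<longrightarrow>
              \<omega> \<in> {\<omega> \<in> space M. \<forall>j<J. \<exists>(y, i)\<in>E x j. g \<omega> y i \<le> t}"
            using c
          proof eventually_elim
            case (elim \<omega>)
            \<comment> \<open>Upward deviations are null events, so a deviation means that
              \<open>V n x\<close> is too small, hence that no copy was good.\<close>
            have "V n x \<omega> \<le> n * c"
              by (intro best_total_le actions) (use elim in auto)
            moreover have "0 < \<epsilon> * real n" using \<epsilon> \<open>0 < n\<close> by simp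
            ultimately have "V n x \<omega> \<le> (c - \<epsilon>) * real n" if "\<epsilon> * real n \<le> \<bar>V n x \<omega> - c * real n\<bar>"
              using that by (simp add: algebra_simps abs_if split: if_splits)
            then show ?case using good[of \<omega>] by (force simp: not_less)
          qed
          have "(\<lambda>\<omega>. g \<omega> y i) \<in> borel_measurable M" if "(y, i) \<in> E x j" for y i j
            using that E(1)[of x j] by (intro payoff_measurable) auto
          then show "{\<omega> \<in> space M. \<forall>j<J. \<exists>(y, i)\<in>E x j. g \<omega> y i \<le> t} \<in> events"
            using E(2) by (intro sets.sets_Collect_countable_All sets.sets_Collect_imp sets.sets_Collect_finite_Ex)
              (auto simp: case_prod_beta)
        qed
        also have "\<dots> \<le> exp (- (p ^ l) * real J)"
          using p E disj by (intro prob_no_good_edge_set_le) auto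
        also have "\<dots> \<le> exp (- (p ^ l) * (sqrt (real n) - 1))"
          using J(2) p(1) by simp
        also have "\<dots> = exp (p ^ l) * exp (- (p ^ l) * sqrt (real n))"
          by (simp add: algebra_simps flip: exp_add)
        finally show "prob {\<omega> \<in> space M. \<epsilon> * real n \<le> \<bar>V n x \<omega> - c * real n\<bar>}
          \<le> exp (p ^ l) * exp (- (p ^ l) * sqrt (real n))" .
      qed
    qed
    then show "\<exists>K. \<exists>\<kappa>>0. \<forall>\<^sub>F n in sequentially. \<forall>x.
      prob {\<omega> \<in> space M. \<epsilon> * real n \<le> \<bar>V n x \<omega> - c * real n\<bar>} \<le> K * exp (- \<kappa> * sqrt (real n))"
      using p(1) by (intro exI[of _ "exp (p ^ l)"] exI[of _ "p ^ l"] conjI) auto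
  qed
  then show ?thesis by blast
qed

end

section \<open>Directed action sets\<close>

text \<open>For \<open>N > n ^ 4\<close> put \<open>m = floor_sqrt N\<close>: then
  \<open>n\<^sup>2 \<le> m < N\<close> and \<open>m\<^sup>2 \<le> N \<le> m ^ 4\<close>, so
  \<open>b n \<le> b m \<le> b N\<close> by induction. The shift in \<open>n0 + 2\<close> gives
  \<open>m \<ge> 2\<close> and thus \<open>m + 1 \<le> m\<^sup>2\<close>. Once \<open>b n\<close>
  bounds all terms from \<open>n\<^sup>2\<close> on from below, the limit is the supremum of a
  tail.\<close>

lemma square_step_monotone_imp_convergent:
  fixes b :: "nat \<Rightarrow> real"
  assumes bdd: "\<And>n. \<bar>b n\<bar> \<le> B"
    and step: "\<And>n N. n0 \<le> n \<Longrightarrow> n\<^sup>2 \<le> N \<Longrightarrow> N \<le> n ^ 4 \<Longrightarrow> b n \<le> b N"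
  shows "convergent b"
proof -
  have mono: "b n \<le> b N" if n: "n0 + 2 \<le> n" and "n\<^sup>2 \<le> N" for n N
    using that(2)
  proof (induction N rule: less_induct)
    case (less N)
    show ?case
    proof (cases "N \<le> n ^ 4")
      case False
      define m where "m = floor_sqrt N"
      have m: "m\<^sup>2 \<le> N" "N < (Suc m)\<^sup>2"
        by (simp_all add: m_def Suc_floor_sqrt_power2_gt)
      have "(n\<^sup>2)\<^sup>2 \<le> N" using False by (simp flip: power_mult)
      then have nm: "n\<^sup>2 \<le> m" unfolding m_def by (simp add: le_floor_sqrt_iff)
      have "n * 2 \<le> n\<^sup>2" using n by (simp add: power2_eq_square)
      then have m2: "n0 + 2 \<le> m" using nm n by linarith
      have "m * 2 \<le> m\<^sup>2" using m2 by (simp add: power2_eq_square)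
      then have "m < N" using m m2 by linarith
      have "Suc m \<le> m\<^sup>2" using \<open>m * 2 \<le> m\<^sup>2\<close> m2 by linarith
      then have "(Suc m)\<^sup>2 \<le> (m\<^sup>2)\<^sup>2" by (rule power_mono) simp
      then have "N \<le> m ^ 4" using m by (simp flip: power_mult)
      with step[of m N] less.IH[OF \<open>m < N\<close> nm] m m2 show ?thesis by simp
    qed (use step less.prems n in auto)
  qed
  define L where "L = Sup (b ` {n0 + 2..})"
  have bdda: "bdd_above (b ` {n0 + 2..})"
    using bdd by (intro bdd_aboveI[of _ B]) (auto simp: abs_le_iff)
  have "b \<longlonglongrightarrow> L"
  proof (rule tendstoI)
    fix e :: real assume "0 < e"
    then have "L - e < L" by simp
    then have "\<exists>v\<in>b ` {n0 + 2..}. L - e < v"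
      unfolding L_def by (intro less_cSupD) auto
    then obtain n where n: "n0 + 2 \<le> n" "L - e < b n" by auto
    show "\<forall>\<^sub>F N in sequentially. dist (b N) L < e"
      using eventually_ge_at_top[of "n\<^sup>2"] eventually_ge_at_top[of "n0 + 2"]
    proof eventually_elim
      case (elim N)
      have "b N \<le> L" unfolding L_def using elim bdda by (intro cSup_upper) auto
      then show ?case using mono[OF n(1) elim(1)] n(2) \<open>0 < e\<close> by (simp add: dist_real_def)
    qed
  qed
  then show ?thesis by (rule convergentI)
qed

locale directed_actions =
  fixes I :: "(int ^ 'd) set" and \<phi> :: "int ^ 'd \<Rightarrow> real"
  assumes finite_I: "finite I" and nonempty_I: "I \<noteq> {}"
    and additive: "\<phi> (x + y) = \<phi> x + \<phi> y" and ge_one: "i \<in> I \<Longrightarrow> 1 \<le> \<phi> i"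
begin

lemmas I = finite_I nonempty_I

text \<open>Slabs between consecutive integer values of \<open>\<phi>\<close>. Since
  \<open>nat\<close> merges all negative ones, levels are only used where \<open>\<phi>\<close> is
  nonnegative; later all paths are translated to start at 0.\<close>

definition level :: "int ^ 'd \<Rightarrow> nat" where "level x = nat \<lfloor>\<phi> x\<rfloor>"

lemma level_step:
  assumes "0 \<le> \<phi> x" "i \<in> I" shows "level x < level (x + i)" "0 \<le> \<phi> (x + i)"
  using ge_one[OF assms(2)] assms(1) additive[of x i] unfolding level_def by linarith+

text \<open>A path beyond level \<open>l\<close> never returns to it.\<close>

lemma best_total_above_level:
  assumes "\<And>y i. level y \<noteq> l \<Longrightarrow> i \<in> I \<Longrightarrow> \<eta> y i = \<eta>' y i" and "0 \<le> \<phi> x" "l < level x"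
  shows "best_total I n x \<eta> = best_total I n x \<eta>'"
  using assms(2,3)
proof (induction n arbitrary: x)
  case (Suc n)
  have "\<eta> x i + best_total I n (x + i) \<eta> = \<eta>' x i + best_total I n (x + i) \<eta>'" if "i \<in> I" for i
    using Suc.IH[of "x + i"] level_step[OF Suc.prems(1) that] Suc.prems assms(1)[of x i] that by simp
  then show ?case by (simp cong: image_cong_simp)
qed simp

text \<open>The level strictly increases along a path, so a path uses at most one payoff of each level.\<close>

lemma best_total_level_le:
  assumes agree: "\<And>y i. level y \<noteq> l \<Longrightarrow> i \<in> I \<Longrightarrow> \<eta> y i = \<eta>' y i"
    and diff: "\<And>y i. i \<in> I \<Longrightarrow> \<eta> y i \<le> \<eta>' y i + B" and "0 \<le> B" and "0 \<le> \<phi> x"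
  shows "best_total I n x \<eta> \<le> best_total I n x \<eta>' + B"
  using assms(4)
proof (induction n arbitrary: x)
  case (Suc n)
  show ?case
  proof (rule best_total_leI[OF I])
    fix i assume i: "i \<in> I"
    note st = level_step[OF Suc.prems i]
    have "\<eta> x i + best_total I n (x + i) \<eta> \<le> \<eta>' x i + best_total I n (x + i) \<eta>' + B"
    proof (cases "level x = l")
      case True
      have "best_total I n (x + i) \<eta> = best_total I n (x + i) \<eta>'"
        using agree st True by (intro best_total_above_level[of l]) auto
      then show ?thesis using diff[OF i, of x] by simp
    next
      case False
      then show ?thesis using agree[OF False i] Suc.IH[OF st(2)] by simp
    qed
    then show "\<eta> x i + best_total I n (x + i) \<eta> \<le> best_total I (Suc n) x \<eta>' + B"
      using best_total_ge[OF I i, of \<eta>' x n] by simp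
  qed
qed (use \<open>0 \<le> B\<close> in simp)

text \<open>Bounds the number of levels within reach of the origin, which is the number of
  independent groups in the concentration inequality.\<close>

lemma functional_reach_box:
  assumes "y \<in> reach_box I 0 n" shows "0 \<le> \<phi> y" "\<phi> y \<le> n * sum \<phi> I"
proof -
  have zero: "\<phi> 0 = 0" using additive[of 0 0] by simp
  have mult: "\<phi> (int k *s i) = k * \<phi> i" for k i
  proof (induction k)
    case (Suc k)
    have "int (Suc k) *s i = int k *s i + i" by (simp add: vec_eq_iff algebra_simps)
    then show ?case using Suc by (simp add: additive algebra_simps)
  qed (simp add: zero)
  have sum: "\<phi> (sum f A) = (\<Sum>a\<in>A. \<phi> (f a))" if "finite A" for f :: "int ^ 'd \<Rightarrow> int ^ 'd" and A
    using that by (induction A) (auto simp: zero additive)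
  obtain k where k: "k \<in> I \<rightarrow>\<^sub>E {..n}" "y = 0 + (\<Sum>i\<in>I. int (k i) *s i)"
    using assms unfolding reach_box_def by blast
  then have y: "\<phi> y = (\<Sum>i\<in>I. k i * \<phi> i)"
    by (simp add: sum[OF finite_I] mult)
  have pos: "0 \<le> \<phi> i" if "i \<in> I" for i using ge_one[OF that] by simp
  then show "0 \<le> \<phi> y" unfolding y by (intro sum_nonneg) auto
  show "\<phi> y \<le> n * sum \<phi> I"
    unfolding y sum_distrib_left using k pos by (intro sum_mono mult_right_mono) (auto simp: PiE_iff)
qed

end

section \<open>Deviation from the mean and convergence of the means\<close>

context pmdp
begin

text \<open>Seen from any \<open>x\<close>, the payoffs in the window \<open>J\<close> have the same
  product law. So \<open>V n x\<close> can be studied on one product space, with a mean that does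
  not depend on \<open>x\<close>.\<close>

lemma payoffs_shifted_law:
  assumes J: "J \<subseteq> UNIV \<times> I" "J \<noteq> {}" and i0: "i0 \<in> I"
  shows "distr M (PiM J (\<lambda>_. borel)) (\<lambda>\<omega>. \<lambda>e\<in>J. g \<omega> (x + fst e) (snd e)) =
    PiM J (\<lambda>_. distr M borel (\<lambda>\<omega>. g \<omega> 0 i0))"
proof -
  define X where "X = (\<lambda>(y, i) \<omega>. g \<omega> y i)"
  \<comment> \<open>Restricting to singletons and then evaluating renames the index
    \<open>(x + fst e, snd e)\<close> to \<open>e\<close>, which transports independence along the
    shift.\<close>
  define K where "K e = {(x + fst e, snd e)}" for e :: "(int ^ 'd) \<times> (int ^ 'd)"
  have "indep_vars (\<lambda>e. PiM (K e) (\<lambda>_. borel)) (\<lambda>e \<omega>. restrict (\<lambda>i. X i \<omega>) (K e)) J"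
    using J indep_payoffs
    by (intro indep_vars_restrict[where I = "UNIV \<times> I"]) (auto simp: K_def X_def disjoint_family_on_def prod_eq_iff)
  then have "indep_vars (\<lambda>_. borel) (\<lambda>e \<omega>. (restrict (\<lambda>i. X i \<omega>) (K e)) (x + fst e, snd e)) J"
    by (rule indep_vars_compose2[where Y = "\<lambda>e u. u (x + fst e, snd e)"]) (simp add: K_def)
  then have indep: "indep_vars (\<lambda>_. borel) (\<lambda>e \<omega>. g \<omega> (x + fst e) (snd e)) J"
    by (simp add: K_def X_def)
  have rv: "(\<lambda>\<omega>. g \<omega> (x + fst e) (snd e)) \<in> borel_measurable M" if "e \<in> J" for e
    using that J by (intro payoff_measurable) auto
  have "distr M (PiM J (\<lambda>_. borel)) (\<lambda>\<omega>. \<lambda>e\<in>J. g \<omega> (x + fst e) (snd e)) =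
      PiM J (\<lambda>e. distr M borel (\<lambda>\<omega>. g \<omega> (x + fst e) (snd e)))"
    using indep_vars_iff_distr_eq_PiM'[OF J(2), of "\<lambda>e \<omega>. g \<omega> (x + fst e) (snd e)" "\<lambda>_. borel"] rv indep by simp
  also have "\<dots> = PiM J (\<lambda>_. distr M borel (\<lambda>\<omega>. g \<omega> 0 i0))"
    using J i0 by (intro PiM_cong identically_distributed_payoffs) auto
  finally show ?thesis .
qed

text \<open>The groups are the levels, at most \<open>n * sum \<phi> I + 1\<close> of them. Changing
  one level changes the optimum by at most \<open>2 * C\<close>, so the denominator
  \<open>2 * (2 * C)\<^sup>2\<close> gives the constant 8. The lower tail comes from
  \<open>- f\<close>.\<close>

lemma directed_deviation:
  assumes \<phi>: "directed_actions I \<phi>" and C: "0 < C" "\<And>\<omega> x i. \<omega> \<in> space M \<Longrightarrow> i \<in> I \<Longrightarrow> \<bar>g \<omega> x i\<bar> \<le> C"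
  shows "\<exists>m. \<forall>x. \<forall>a>0. prob {\<omega> \<in> space M. a \<le> \<bar>V n x \<omega> - m\<bar>}
    \<le> 2 * exp (- (a\<^sup>2 / (8 * C\<^sup>2 * (n * sum \<phi> I + 1))))"
proof -
  interpret directed_actions I \<phi> by fact
  obtain i0 where i0: "i0 \<in> I" using nonempty_actions by blast
  define J where "J = reach_box I 0 n \<times> I"
  have J: "J \<subseteq> UNIV \<times> I" "J \<noteq> {}" "finite J"
    using nonempty_actions reach_box_self[of 0 I n] finite_reach_box finite_actions by (auto simp: J_def)
  define N where "N = (\<lambda>_ :: (int ^ 'd) \<times> (int ^ 'd). distr M borel (\<lambda>\<omega>. g \<omega> 0 i0))"
  have N: "prob_space (N e)" for e
    unfolding N_def using i0 by (intro prob_space_distr) simp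
  interpret P: prob_space "PiM J N" by (intro prob_space_PiM N)
  \<comment> \<open>The concentration inequality asks for bounds at every point of the product
    space, whereas the payoffs obey theirs only as values of \<open>g\<close>. Clipping enforces the
    bound and leaves the sampled payoffs unchanged.\<close>
  define trunc where "trunc u y i = (if (y, i) \<in> J then max (- C) (min C (u (y, i))) else 0)" for u y i
  have trunc_bound: "\<bar>trunc u y i\<bar> \<le> C" for u y i using C(1) by (auto simp: trunc_def)
  define f where "f u = best_total I n 0 (trunc u)" for u
  have sets_N: "sets (PiM J N) = sets (PiM J (\<lambda>_. borel))"
    by (intro sets_PiM_cong) (auto simp: N_def)
  have trunc_meas: "(\<lambda>u. trunc u y i) \<in> borel_measurable (PiM J N)" for y i
  proof (cases "(y, i) \<in> J")
    case True
    then have "(\<lambda>u. u (y, i)) \<in> borel_measurable (PiM J N)"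
      unfolding measurable_cong_sets[OF sets_N refl] by measurable
    with True show ?thesis unfolding trunc_def by simp
  qed (simp add: trunc_def)
  have f_meas [measurable]: "f \<in> borel_measurable (PiM J N)"
    unfolding f_def by (intro best_total_measurable actions trunc_meas)
  have f_bound: "\<bar>f u\<bar> \<le> n * C" for u
    unfolding f_def by (intro best_total_bounded actions trunc_bound)
  define L where "L = {..nat \<lfloor>n * sum \<phi> I\<rfloor>}"
  have \<phi>_pos: "0 \<le> sum \<phi> I" using ge_one by (intro sum_nonneg) force
  have card_L: "card L \<le> n * sum \<phi> I + 1"
  proof -
    have "0 \<le> n * sum \<phi> I" using \<phi>_pos by simp
    then show ?thesis unfolding L_def by simp
  qed
  have sL: "(level \<circ> fst) ` J \<subseteq> L"
    unfolding L_def J_def level_def using functional_reach_box by (auto intro!: nat_mono floor_mono)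
  have le: "f u \<le> f v + 2 * C" if "\<And>e. e \<in> J \<Longrightarrow> (level \<circ> fst) e \<noteq> l \<Longrightarrow> u e = v e" for l u v
    unfolding f_def
  proof (rule best_total_level_le[where l = l])
    show "trunc u y i = trunc v y i" if "level y \<noteq> l" "i \<in> I" for y i
      using that \<open>\<And>e. e \<in> J \<Longrightarrow> (level \<circ> fst) e \<noteq> l \<Longrightarrow> u e = v e\<close>[of "(y, i)"] by (simp add: trunc_def)
    show "trunc u y i \<le> trunc v y i + 2 * C" for y i
      using trunc_bound[of u y i] trunc_bound[of v y i] by (simp add: abs_le_iff)
    show "0 \<le> \<phi> 0" using functional_reach_box[OF reach_box_self] by simp
  qed (use C in simp)
  have bd: "\<bar>f u - f v\<bar> \<le> 2 * C" if "\<And>e. e \<in> J \<Longrightarrow> (level \<circ> fst) e \<noteq> l \<Longrightarrow> u e = v e" for l u v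
    using le[of l u v] le[of l v u] that by fastforce
  define m where "m = (\<integral>u. f u \<partial>PiM J N)"
  show ?thesis
  proof (intro exI allI impI)
    fix x :: "int ^ 'd" and a :: real assume a: "0 < a"
    define X where "X \<omega> = (\<lambda>e\<in>J. g \<omega> (x + fst e) (snd e))" for \<omega>
    have X [measurable]: "X \<in> M \<rightarrow>\<^sub>M PiM J (\<lambda>_. borel)"
      unfolding X_def using J by (intro measurable_restrict payoff_measurable) auto
    have law: "distr M (PiM J (\<lambda>_. borel)) X = PiM J N"
      unfolding X_def N_def by (rule payoffs_shifted_law[OF J(1,2) i0])
    have V: "V n x \<omega> = f (X \<omega>)" if \<omega>: "\<omega> \<in> space M" for \<omega>
    proof -
      have "V n x \<omega> = best_total I n 0 (\<lambda>y. g \<omega> (x + y))"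
        using best_total_translate[OF actions, of n x 0 "g \<omega>"] by simp
      also have "\<dots> = f (X \<omega>)"
        unfolding f_def
      proof (rule best_total_cong[OF actions])
        fix y i assume "y \<in> reach_box I 0 n" "i \<in> I"
        then show "g \<omega> (x + y) i = trunc (X \<omega>) y i"
          using C(2)[OF \<omega>, of i "x + y"] by (auto simp: trunc_def X_def J_def abs_le_iff)
      qed
      finally show ?thesis .
    qed
    define b where "b = exp (- (a\<^sup>2 / (8 * C\<^sup>2 * (n * sum \<phi> I + 1))))"
    have L0: "L \<noteq> {}" "finite L" "0 < real (card L)" by (auto simp: L_def)
    have exp_le: "exp (- (a\<^sup>2 / (2 * (2 * C)\<^sup>2 * card L))) \<le> b"
    proof -
      have "a\<^sup>2 / (8 * C\<^sup>2 * (n * sum \<phi> I + 1)) \<le> a\<^sup>2 / (8 * C\<^sup>2 * card L)"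
        using card_L L0 C(1) by (intro divide_left_mono mult_left_mono mult_pos_pos) auto
      then show ?thesis by (simp add: b_def power2_eq_square)
    qed
    have up: "P.prob {u \<in> space (PiM J N). a \<le> f u - m} \<le> b"
      unfolding m_def
    proof (rule order_trans[OF mcdiarmid_ge[OF N L0(2,1) J(3) sL f_meas f_bound _ _ a] exp_le])
      show "\<bar>f u - f v\<bar> \<le> 2 * C" if "\<And>e. e \<in> J \<Longrightarrow> (level \<circ> fst) e \<noteq> l \<Longrightarrow> u e = v e" for l u v
        using that by (rule bd)
    qed (use C in simp)
    have down: "P.prob {u \<in> space (PiM J N). a \<le> - f u - (\<integral>u. - f u \<partial>PiM J N)} \<le> b"
    proof (rule order_trans[OF mcdiarmid_ge[OF N L0(2,1) J(3) sL _ _ _ _ a] exp_le])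
      show "\<bar>- f u - - f v\<bar> \<le> 2 * C" if "\<And>e. e \<in> J \<Longrightarrow> (level \<circ> fst) e \<noteq> l \<Longrightarrow> u e = v e" for l u v
        using bd[of l u v, OF that] by linarith
      show "\<bar>- f u\<bar> \<le> n * C" for u using f_bound by simp
    qed (use C in simp_all)
    have "prob {\<omega> \<in> space M. a \<le> \<bar>V n x \<omega> - m\<bar>} = prob (X -` {u \<in> space (PiM J N). a \<le> \<bar>f u - m\<bar>} \<inter> space M)"
      using measurable_space[OF X] by (intro arg_cong[where f = prob]) (auto simp: V space_PiM N_def)
    also have "\<dots> = P.prob {u \<in> space (PiM J N). a \<le> \<bar>f u - m\<bar>}"
      by (subst (2) law[symmetric], subst measure_distr) (use sets_N in \<open>auto simp: sets_N[symmetric]\<close>)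
    also have "\<dots> \<le> P.prob ({u \<in> space (PiM J N). a \<le> f u - m} \<union>
        {u \<in> space (PiM J N). a \<le> - f u - (\<integral>u. - f u \<partial>PiM J N)})"
      by (intro P.finite_measure_mono) (auto simp: m_def)
    also have "\<dots> \<le> b + b"
      using up down by (intro order_trans[OF measure_Un_le] add_mono) auto
    finally show "prob {\<omega> \<in> space M. a \<le> \<bar>V n x \<omega> - m\<bar>}
        \<le> 2 * exp (- (a\<^sup>2 / (8 * C\<^sup>2 * (n * sum \<phi> I + 1))))"
      by (simp add: b_def)
  qed
qed

text \<open>Concentration at scale \<open>n\<close> holds simultaneously at all points within distance \<open>n\<^sup>4\<close>, so paths
  of length \<open>N \<le> n\<^sup>4\<close> can be built from blocks of length \<open>n\<close>.\<close>

lemma deviation_scale_step: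
  assumes C: "0 < C" "\<And>\<omega> x i. \<omega> \<in> space M \<Longrightarrow> i \<in> I \<Longrightarrow> \<bar>g \<omega> x i\<bar> \<le> C" and "0 < \<kappa>"
    and dev: "\<And>n x. 0 < n \<Longrightarrow> prob {\<omega> \<in> space M. n powr (3/4) \<le> \<bar>V n x \<omega> - A n\<bar>} \<le> 2 * exp (- \<kappa> * sqrt (real n))"
    and A: "\<And>n. \<bar>A n\<bar> \<le> n * C"
  shows "\<forall>\<^sub>F n::nat in sequentially. \<forall>N. n\<^sup>2 \<le> N \<longrightarrow> N \<le> n ^ 4 \<longrightarrow>
    A n / n - 2 * n powr (- 1/4) - 2 * C / n \<le> A N / N"
proof -
  define d where "d = real (card I)"
  have "\<forall>\<^sub>F n::nat in sequentially. (real n ^ 4 + 1) powr d * (2 * exp (- \<kappa> * sqrt (real n))) + 2 * exp (- \<kappa> * sqrt (real n)) < 1"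
    using \<open>0 < \<kappa>\<close> by real_asymp
  then show ?thesis
    using eventually_gt_at_top[of 0]
  proof (eventually_elim, intro allI impI)
    fix n N :: nat
    assume small: "(real n ^ 4 + 1) powr d * (2 * exp (- \<kappa> * sqrt (real n))) + 2 * exp (- \<kappa> * sqrt (real n)) < 1"
      and n: "0 < n" and N: "n\<^sup>2 \<le> N" "N \<le> n ^ 4"
    have "n * 1 \<le> n\<^sup>2" using n unfolding power2_eq_square by (intro mult_left_mono) auto
    then have nN: "n \<le> N" "0 < N" using N n by auto
    define D where "D m x = {\<omega> \<in> space M. real m powr (3/4) \<le> \<bar>V m x \<omega> - A m\<bar>}" for m x
    have D_meas [measurable]: "D m x \<in> events" for m x unfolding D_def by measurable
    define R where "R = reach_box I 0 N"
    have fin: "finite R" unfolding R_def by (rule finite_reach_box[OF finite_actions])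
    have "prob ((\<Union>x\<in>R. D n x) \<union> D N 0) \<le> prob (\<Union>x\<in>R. D n x) + prob (D N 0)"
      using fin by (intro measure_Un_le) auto
    also have "\<dots> \<le> (\<Sum>x\<in>R. prob (D n x)) + prob (D N 0)"
      using fin by (intro add_right_mono finite_measure_subadditive_finite) auto
    also have "\<dots> \<le> (\<Sum>x\<in>R. 2 * exp (- \<kappa> * sqrt (real n))) + 2 * exp (- \<kappa> * sqrt (real N))"
      unfolding D_def using dev n nN by (intro add_mono sum_mono) auto
    also have "\<dots> \<le> (real n ^ 4 + 1) powr d * (2 * exp (- \<kappa> * sqrt (real n))) + 2 * exp (- \<kappa> * sqrt (real n))"
    proof (intro add_mono)
      have "card R \<le> (n ^ 4 + 1) ^ card I"
        unfolding R_def using N by (intro order_trans[OF card_reach_box_le[OF finite_actions]] power_mono) auto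
      then have "real (card R) \<le> real ((n ^ 4 + 1) ^ card I)" by (rule of_nat_mono)
      also have "\<dots> = (real n ^ 4 + 1) powr d"
        unfolding d_def by (subst powr_realpow) (auto simp: add.commute intro: add_pos_nonneg)
      finally show "(\<Sum>x\<in>R. 2 * exp (- \<kappa> * sqrt (real n))) \<le> (real n ^ 4 + 1) powr d * (2 * exp (- \<kappa> * sqrt (real n)))"
        unfolding sum_constant by (intro mult_right_mono) auto
      show "2 * exp (- \<kappa> * sqrt (real N)) \<le> 2 * exp (- \<kappa> * sqrt (real n))"
        using nN \<open>0 < \<kappa>\<close> by simp
    qed
    also note small
    finally have lt: "prob ((\<Union>x\<in>R. D n x) \<union> D N 0) < 1" .
    \<comment> \<open>A single good \<open>\<omega>\<close> suffices, because the inequality to be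
      shown concerns the deterministic numbers \<open>A n\<close> and \<open>A N\<close>.\<close>
    have "(\<Union>x\<in>R. D n x) \<union> D N 0 \<noteq> space M"
      using lt prob_space by auto
    moreover have "(\<Union>x\<in>R. D n x) \<union> D N 0 \<subseteq> space M" by (auto simp: D_def)
    ultimately obtain \<omega> where \<omega>: "\<omega> \<in> space M" "\<And>x. x \<in> R \<Longrightarrow> \<omega> \<notin> D n x" "\<omega> \<notin> D N 0"
      by blast
    define \<alpha> where "\<alpha> = A n - n powr (3/4)"
    define q r where "q = N div n" and "r = N mod n"
    have qr: "q * n + r = N" "r \<le> n" using n by (auto simp: q_def r_def less_imp_le)
    have low: "\<alpha> \<le> V n y \<omega>" if "y \<in> R" for y
      using \<omega>(1) \<omega>(2)[OF that] by (simp add: D_def \<alpha>_def)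
    have "q * \<alpha> - r * C \<le> V (q * n + r) 0 \<omega>"
      using low unfolding R_def qr(1)[symmetric] by (intro best_total_chain_ge actions C(2) \<omega>(1))
    moreover have "V N 0 \<omega> \<le> A N + N powr (3/4)"
      using \<omega>(1,3) by (simp add: D_def)
    ultimately have up: "q * \<alpha> - r * C \<le> A N + N powr (3/4)" using qr by simp
    have \<alpha>_le: "\<alpha> / n \<le> C"
      using A[of n] n by (simp add: \<alpha>_def divide_le_eq abs_le_iff) (smt (verit) powr_ge_zero mult.commute)
    have "real N - real r = real q * real n" by (simp flip: qr(1))
    then have "q * \<alpha> = (real N - r) * (\<alpha> / n)" using n by simp
    also have "\<dots> = N * (\<alpha> / n) - r * (\<alpha> / n)" by (rule left_diff_distrib)
    also have "\<dots> \<ge> N * (\<alpha> / n) - r * C"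
      using \<alpha>_le by (intro diff_left_mono mult_left_mono) auto
    finally have "N * (\<alpha> / n) - r * C \<le> q * \<alpha>" .
    moreover have "r * C \<le> n * C" using qr(2) C(1) by simp
    \<comment> \<open>One \<open>n * C\<close> pays for the leftover steps of the chain, the other
      for replacing \<open>q\<close> by \<open>N / n\<close>.\<close>
    ultimately have "N * (\<alpha> / n) \<le> A N + N powr (3/4) + 2 * (n * C)" using up by linarith
    then have "\<alpha> / n \<le> (A N + N powr (3/4) + 2 * (n * C)) / N"
      using nN by (simp add: pos_le_divide_eq mult.commute)
    also have "\<dots> = A N / N + N powr (3/4) / N + 2 * C * (n / N)"
      by (simp add: add_divide_distrib)
    also have "\<dots> \<le> A N / N + n powr (- 1/4) + 2 * C * (1 / n)"
    proof (intro add_mono mult_left_mono order_refl)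
      have "N powr (3/4) / N = N powr (3/4 - 1)"
        using nN by (subst powr_diff) simp
      also have "\<dots> \<le> n powr (3/4 - 1)" using nN n by (intro powr_mono2') auto
      finally show "N powr (3/4) / N \<le> n powr (- 1/4)" by simp
      have "real n * real n \<le> real N" using N(1) by (simp add: power2_eq_square flip: of_nat_mult)
      then show "real n / N \<le> 1 / n" using n nN by (simp add: field_simps)
    qed (use C in auto)
    finally have "\<alpha> / n \<le> A N / N + n powr (- 1/4) + 2 * C * (1 / n)" .
    moreover have "\<alpha> / n = A n / n - n powr (- 1/4)"
    proof -
      have "n powr (3/4) / n = n powr (3/4 - 1)" using n by (subst powr_diff) simp
      then show ?thesis by (simp add: \<alpha>_def diff_divide_distrib)
    qed
    ultimately show "A n / n - 2 * n powr (- 1/4) - 2 * C / n \<le> A N / N" by simp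
  qed
qed

lemma directed_imp_concentrated:
  assumes \<phi>: "directed_actions I \<phi>"
  shows "\<exists>c. concentrated c"
proof -
  interpret directed_actions I \<phi> by fact
  obtain C0 where C0: "\<And>\<omega> x i. \<omega> \<in> space M \<Longrightarrow> i \<in> I \<Longrightarrow> \<bar>g \<omega> x i\<bar> \<le> C0"
    using bounded_payoffs by blast
  define C where "C = \<bar>C0\<bar> + 1"
  have C: "0 < C" "\<And>\<omega> x i. \<omega> \<in> space M \<Longrightarrow> i \<in> I \<Longrightarrow> \<bar>g \<omega> x i\<bar> \<le> C"
    unfolding C_def using C0 by simp (meson C0 abs_ge_self add_increasing2 order_trans zero_le_one)
  define S where "S = sum \<phi> I"
  have S: "0 \<le> S" unfolding S_def using ge_one by (intro sum_nonneg) force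
  define m where "m n = (SOME m. \<forall>x. \<forall>a>0. prob {\<omega> \<in> space M. a \<le> \<bar>V n x \<omega> - m\<bar>}
    \<le> 2 * exp (- (a\<^sup>2 / (8 * C\<^sup>2 * (real n * S + 1)))))" for n
  have m: "prob {\<omega> \<in> space M. a \<le> \<bar>V n x \<omega> - m n\<bar>} \<le> 2 * exp (- (a\<^sup>2 / (8 * C\<^sup>2 * (real n * S + 1))))"
    if "0 < a" for n x a
    using someI_ex[OF directed_deviation[OF \<phi> C, of n]] that unfolding m_def S_def by blast
  \<comment> \<open>The chosen centre \<open>m n\<close> comes without a bound. Projecting it to the
    range of \<open>V n x\<close> cannot increase any deviation.\<close>
  define A where "A n = max (- (n * C)) (min (n * C) (m n))" for n
  have A: "\<bar>A n\<bar> \<le> n * C" for n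
  proof -
    have "0 \<le> n * C" using C(1) by simp
    then show ?thesis unfolding A_def by linarith
  qed
  have VC: "\<bar>V n x \<omega>\<bar> \<le> n * C" if "\<omega> \<in> space M" for n x \<omega>
    by (intro best_total_bounded actions C(2) that)
  \<comment> \<open>For deviations \<open>n powr (3/4)\<close> the exponent has numerator
    \<open>n * sqrt n\<close>; the denominator is at most \<open>8 * C\<^sup>2 * n * (S + 1)\<close>
    for \<open>n \<ge> 1\<close>, which leaves \<open>\<kappa> * sqrt n\<close>.\<close>
  define \<kappa> where "\<kappa> = 1 / (8 * C\<^sup>2 * (S + 1))"
  have \<kappa>: "0 < \<kappa>" using C(1) S by (simp add: \<kappa>_def)
  have dev: "prob {\<omega> \<in> space M. n powr (3/4) \<le> \<bar>V n x \<omega> - A n\<bar>} \<le> 2 * exp (- \<kappa> * sqrt (real n))"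
    if n: "0 < n" for n x
  proof -
    have "prob {\<omega> \<in> space M. n powr (3/4) \<le> \<bar>V n x \<omega> - A n\<bar>} \<le> prob {\<omega> \<in> space M. n powr (3/4) \<le> \<bar>V n x \<omega> - m n\<bar>}"
    proof (rule finite_measure_mono)
      have "\<bar>V n x \<omega> - A n\<bar> \<le> \<bar>V n x \<omega> - m n\<bar>" if "\<omega> \<in> space M" for \<omega>
        using VC[OF that, of n x] unfolding A_def by linarith
      then show "{\<omega> \<in> space M. n powr (3/4) \<le> \<bar>V n x \<omega> - A n\<bar>} \<subseteq> {\<omega> \<in> space M. n powr (3/4) \<le> \<bar>V n x \<omega> - m n\<bar>}"
        by (auto intro: order_trans)
    qed measurable
    also have "\<dots> \<le> 2 * exp (- ((n powr (3/4))\<^sup>2 / (8 * C\<^sup>2 * (real n * S + 1))))"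
      using n by (intro m) simp
    also have "\<dots> \<le> 2 * exp (- \<kappa> * sqrt (real n))"
    proof -
      have "(n powr (3/4))\<^sup>2 = n * sqrt (real n)"
        using n by (simp add: powr_half_sqrt[symmetric] powr_mult_base powr_powr flip: powr_realpow)
      moreover have "\<kappa> * sqrt (real n) = n * sqrt (real n) / (8 * C\<^sup>2 * (n * (S + 1)))"
        using n by (simp add: \<kappa>_def)
      moreover have "\<dots> \<le> n * sqrt (real n) / (8 * C\<^sup>2 * (real n * S + 1))"
      proof (intro divide_left_mono mult_left_mono)
        show "real n * S + 1 \<le> n * (S + 1)" using n by (simp add: distrib_left)
        show "0 < 8 * C\<^sup>2 * (n * (S + 1)) * (8 * C\<^sup>2 * (real n * S + 1))"
          using n S C(1) by (intro mult_pos_pos add_nonneg_pos mult_nonneg_nonneg) auto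
      qed auto
      ultimately show ?thesis by simp
    qed
    finally show ?thesis .
  qed
  \<comment> \<open>For \<open>N \<ge> n\<^sup>2\<close> the correction shrinks from
    \<open>n powr (- 1/8)\<close> to at most \<open>n powr (- 1/4)\<close>. For large
    \<open>n\<close> this gain absorbs the error terms of the scale step, so \<open>b\<close>
    satisfies the exact inequality of the convergence criterion.\<close>
  define b where "b n = A n / n - n powr (- 1/8)" for n :: nat
  have "\<forall>\<^sub>F n::nat in sequentially. 3 * n powr (- 1/4) + 2 * C / n \<le> n powr (- 1/8)"
    by real_asymp
  moreover have "\<forall>\<^sub>F n::nat in sequentially. \<forall>N. n\<^sup>2 \<le> N \<longrightarrow> N \<le> n ^ 4 \<longrightarrow>
      A n / n - 2 * n powr (- 1/4) - 2 * C / n \<le> A N / N"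
    by (intro deviation_scale_step[where \<kappa> = \<kappa>] C \<kappa> dev A)
  ultimately have "\<forall>\<^sub>F n::nat in sequentially. \<forall>N. n\<^sup>2 \<le> N \<longrightarrow> N \<le> n ^ 4 \<longrightarrow> b n \<le> b N"
    using eventually_gt_at_top[of 0]
  proof (eventually_elim, intro allI impI)
    fix n N :: nat
    assume *: "\<forall>N. n\<^sup>2 \<le> N \<longrightarrow> N \<le> n ^ 4 \<longrightarrow> A n / n - 2 * n powr (- 1/4) - 2 * C / n \<le> A N / N"
      and n: "0 < n" and err: "3 * n powr (- 1/4) + 2 * C / n \<le> n powr (- 1/8)"
      and N: "n\<^sup>2 \<le> N" "N \<le> n ^ 4"
    have "N powr (- 1/8) \<le> (real n ^ 2) powr (- 1/8)"
      using N(1) n by (intro powr_mono2') (auto simp flip: of_nat_power)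
    also have "\<dots> = (real n powr 2) powr (- 1/8)" using n by simp
    also have "\<dots> = n powr (- 1/4)" by (simp only: powr_powr) simp
    finally show "b n \<le> b N"
      using *[rule_format, OF N] err by (simp add: b_def)
  qed
  then obtain n0 where n0: "\<And>n N. n0 \<le> n \<Longrightarrow> n\<^sup>2 \<le> N \<Longrightarrow> N \<le> n ^ 4 \<Longrightarrow> b n \<le> b N"
    unfolding eventually_sequentially by blast
  have b_bound: "\<bar>b n\<bar> \<le> C + 1" for n
  proof (cases "n = 0")
    case False
    then have "\<bar>A n / n\<bar> \<le> C" using A[of n] by (simp add: abs_divide divide_le_eq mult.commute)
    moreover have "n powr (- 1/8) \<le> 1" using False powr_mono[of "- 1/8" 0 n] by simp
    moreover have "0 \<le> n powr (- 1/8)" by simp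
    ultimately show ?thesis unfolding b_def by linarith
  qed (use C in \<open>simp add: b_def\<close>)
  have "convergent b" by (rule square_step_monotone_imp_convergent[OF b_bound n0])
  then obtain c where "b \<longlonglongrightarrow> c" by (auto simp: convergent_def)
  moreover have "(\<lambda>n::nat. n powr (- 1/8)) \<longlonglongrightarrow> 0" by real_asymp
  ultimately have "(\<lambda>n. b n + n powr (- 1/8)) \<longlonglongrightarrow> c + 0" by (rule tendsto_add)
  then have lim: "(\<lambda>n. A n / n) \<longlonglongrightarrow> c" by (simp add: b_def)
  have "concentrated c"
    unfolding concentrated_def
  proof (intro allI impI)
    fix \<epsilon> :: real assume \<epsilon>: "0 < \<epsilon>"
    have "\<forall>\<^sub>F n in sequentially. \<bar>A n / n - c\<bar> < \<epsilon> / 2"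
      using tendstoD[OF lim, of "\<epsilon> / 2"] \<epsilon> by (simp add: dist_real_def)
    moreover have "\<forall>\<^sub>F n::nat in sequentially. n powr (3/4) \<le> \<epsilon> / 2 * n"
      using \<epsilon> by real_asymp
    ultimately have "\<forall>\<^sub>F n in sequentially. \<forall>x.
        prob {\<omega> \<in> space M. \<epsilon> * real n \<le> \<bar>V n x \<omega> - c * real n\<bar>} \<le> 2 * exp (- \<kappa> * sqrt (real n))"
      using eventually_gt_at_top[of 0]
    proof (eventually_elim, intro allI)
      fix n :: nat and x
      assume close: "\<bar>A n / n - c\<bar> < \<epsilon> / 2" and pow: "n powr (3/4) \<le> \<epsilon> / 2 * n" and n: "0 < n"
      have "A n - c * real n = (A n / n - c) * n" using n by (simp add: field_simps)
      then have "\<bar>A n - c * real n\<bar> = \<bar>A n / n - c\<bar> * n" by (simp add: abs_mult)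
      also have "\<dots> \<le> \<epsilon> / 2 * n" using close by (intro mult_right_mono) auto
      finally have An: "\<bar>A n - c * real n\<bar> \<le> \<epsilon> / 2 * n" .
      have "prob {\<omega> \<in> space M. \<epsilon> * real n \<le> \<bar>V n x \<omega> - c * real n\<bar>}
          \<le> prob {\<omega> \<in> space M. n powr (3/4) \<le> \<bar>V n x \<omega> - A n\<bar>}"
      proof (rule finite_measure_mono)
        show "{\<omega> \<in> space M. \<epsilon> * real n \<le> \<bar>V n x \<omega> - c * real n\<bar>} \<subseteq> {\<omega> \<in> space M. n powr (3/4) \<le> \<bar>V n x \<omega> - A n\<bar>}"
        proof safe
          fix \<omega> assume "\<epsilon> * real n \<le> \<bar>V n x \<omega> - c * real n\<bar>"
          then show "n powr (3/4) \<le> \<bar>V n x \<omega> - A n\<bar>" using An pow by linarith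
        qed
      qed measurable
      also have "\<dots> \<le> 2 * exp (- \<kappa> * sqrt (real n))" by (rule dev[OF n])
      finally show "prob {\<omega> \<in> space M. \<epsilon> * real n \<le> \<bar>V n x \<omega> - c * real n\<bar>} \<le> 2 * exp (- \<kappa> * sqrt (real n))" .
    qed
    with \<kappa> show "\<exists>K. \<exists>\<kappa>>0. \<forall>\<^sub>F n in sequentially. \<forall>x.
      prob {\<omega> \<in> space M. \<epsilon> * real n \<le> \<bar>V n x \<omega> - c * real n\<bar>} \<le> K * exp (- \<kappa> * sqrt (real n))"
      by blast
  qed
  then show ?thesis by blast
qed

section \<open>The two cases combined, and the trivial action set\<close>

lemma concentrated_ex:
  assumes "I \<noteq> {0}"
  shows "\<exists>c. concentrated c"
proof (cases "0 \<in> convex hull (real_vec ` I)")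
  case True
  obtain i where "i \<in> I" "i \<noteq> 0" using assms nonempty_actions by blast
  with convex_combination_zero_imp_loop[OF finite_actions True] loop_imp_concentrated
  show ?thesis by metis
next
  case False
  then obtain \<phi> :: "int ^ 'd \<Rightarrow> real" where "\<And>x y. \<phi> (x + y) = \<phi> x + \<phi> y" "\<And>i. i \<in> I \<Longrightarrow> 1 \<le> \<phi> i"
    using separating_functional[OF finite_actions] by metis
  then have "directed_actions I \<phi>"
    using actions by unfold_locales auto
  then show ?thesis by (rule directed_imp_concentrated)
qed

text \<open>The walk never leaves \<open>z\<close> and collects the same payoff at every stage, so
  the limit is that payoff itself, in general random and dependent on \<open>z\<close>.\<close>

lemma zero_action_limits:
  assumes "I = {0}" "\<omega> \<in> space M"
  shows "(\<lambda>n. stage_value n z \<omega>) \<longlonglongrightarrow> g \<omega> z 0" "(\<lambda>n. payoff n z (block_strategy r) \<omega>) \<longlonglongrightarrow> g \<omega> z 0"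
proof -
  have greedy: "greedy I k x \<eta> = 0" for k x \<eta>
    using greedy_in[OF actions] assms(1) by blast
  have walk: "greedy_walk I r z \<eta> t = z" for r \<eta> t
    by (induction t) (auto simp: greedy)
  have pay: "payoff n z (block_strategy r) \<omega> = g \<omega> z 0" if "0 < n" for n r
    using that by (simp add: payoff_block_strategy greedy_sum_def greedy walk)
  have "stage_value n z \<omega> = payoff n z (block_strategy (\<lambda>t. n - t)) \<omega>" for n
    using assms(2) by (simp add: stage_value_eq payoff_block_strategy greedy_sum_countdown actions)
  then have val: "stage_value n z \<omega> = g \<omega> z 0" if "0 < n" for n
    using pay[OF that] by simp
  show "(\<lambda>n. stage_value n z \<omega>) \<longlonglongrightarrow> g \<omega> z 0"
    using val by (intro tendsto_eventually eventually_mono[OF eventually_gt_at_top[of 0]]) auto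
  show "(\<lambda>n. payoff n z (block_strategy r) \<omega>) \<longlonglongrightarrow> g \<omega> z 0"
    using pay by (intro tendsto_eventually eventually_mono[OF eventually_gt_at_top[of 0]]) auto
qed

end

theorem theorem2p11:
  fixes M :: "'w measure"
    and I :: "(int ^ 'd) set"
    and g :: "'w \<Rightarrow> int ^ 'd \<Rightarrow> int ^ 'd \<Rightarrow> real"
    and z :: "int ^ 'd"
  assumes "pmdp M I g"
  shows "(\<exists>\<sigma>\<in>pmdp.strategies M I g.
            AE \<omega> in M. (\<lambda>n. pmdp.payoff g n z \<sigma> \<omega>) \<longlonglongrightarrow> pmdp.limit_value M I g z \<omega>)
       \<and> pmdp.has_uniform_value M I g z
       \<and> (I \<noteq> {0} \<longrightarrow> (\<exists>c. \<forall>z'. AE \<omega> in M. pmdp.limit_value M I g z' \<omega> = c))"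
proof -
  interpret pmdp M I g by fact
  let ?\<sigma> = "block_strategy (\<lambda>t. snd (block t))"
  have lim: "AE \<omega> in M. convergent (\<lambda>n. stage_value n z \<omega>) \<and> (\<lambda>n. payoff n z ?\<sigma> \<omega>) \<longlonglongrightarrow> limit_value z \<omega>"
  proof (cases "I = {0}")
    case True
    show ?thesis
      unfolding limit_value_def using zero_action_limits[OF True]
      by (intro AE_I2) (metis convergentI limI)
  next
    case False
    then obtain c where "concentrated c" using concentrated_ex by blast
    from concentrated_limits[OF this, of z] show ?thesis
      unfolding limit_value_def by eventually_elim (auto intro: convergentI simp: limI)
  qed
  have "\<exists>c. \<forall>z'. AE \<omega> in M. limit_value z' \<omega> = c" if nontrivial: "I \<noteq> {0}"
  proof -
    obtain c where "concentrated c" using concentrated_ex[OF nontrivial] by blast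
    then have "AE \<omega> in M. limit_value z' \<omega> = c" for z'
      using concentrated_limits[of c z'] unfolding limit_value_def by (auto elim!: eventually_mono simp: limI)
    then show ?thesis by blast
  qed
  moreover have "has_uniform_value z"
    unfolding has_uniform_value_def
  proof (intro conjI allI impI bexI)
    show "AE \<omega> in M. convergent (\<lambda>n. stage_value n z \<omega>)" using lim by (rule eventually_mono) simp
    fix \<epsilon> :: real assume \<epsilon>: "0 < \<epsilon>"
    show "AE \<omega> in M. \<exists>n0. \<forall>n\<ge>n0. limit_value z \<omega> - \<epsilon> \<le> payoff n z ?\<sigma> \<omega>"
      using lim
    proof eventually_elim
      case (elim \<omega>)
      then have "\<forall>\<^sub>F n in sequentially. limit_value z \<omega> - \<epsilon> < payoff n z ?\<sigma> \<omega>"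
        using \<epsilon> by (intro order_tendstoD) auto
      then show ?case by (auto simp: eventually_sequentially intro: less_imp_le)
    qed
  qed (rule block_strategy_in)
  moreover have "\<exists>\<sigma>\<in>strategies. AE \<omega> in M. (\<lambda>n. payoff n z \<sigma> \<omega>) \<longlonglongrightarrow> limit_value z \<omega>"
    using lim block_strategy_in by (intro bexI[of _ ?\<sigma>]) (auto elim: eventually_mono)
  ultimately show ?thesis by blast
qed

end
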